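(* Every abelian monotone sequentially complete C*-algebra is $1$-separably injective (as a complex Banach space).
   Context: A complex Banach space $V$ is called $1$-separably injective if for every complex separable Banach space $Z$ and every closed subspace $Y \subset Z$, every bounded linear operator $T : Y \to V$ extends to a bounded linear operator $\widetilde{T} : Z \to V$ with $\|\widetilde{T}\| = \|T\|$. C*-algebras are complex and are not assumed to be unital. A C*-algebra $A$ is monotone sequentially complete if every norm-bounded increasing sequence in the self-adjoint part $A_{sa}$ of $A$ has a least upper bound in $A_{sa}$ (with respect to the usual order on $A_{sa}$). *)

theory Defs
  imports "HOL-Analysis.Analysis"
begin

section \<open>Complex Banach spaces\<close>

class complex_vector = real_vector +
  fixes scaleC :: "complex \<Rightarrow> 'a \<Rightarrow> 'a" (infixr "*\<^sub>C" 75)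
  assumes scaleC_add_right: "a *\<^sub>C (x + y) = a *\<^sub>C x + a *\<^sub>C y"
    and scaleC_add_left: "(a + b) *\<^sub>C x = a *\<^sub>C x + b *\<^sub>C x"
    and scaleC_scaleC: "a *\<^sub>C (b *\<^sub>C x) = (a * b) *\<^sub>C x"
    and scaleC_one: "1 *\<^sub>C x = x"
    and scaleC_of_real: "complex_of_real r *\<^sub>C x = r *\<^sub>R x"

class complex_normed_vector = complex_vector + real_normed_vector +
  assumes norm_scaleC: "norm (a *\<^sub>C x) = cmod a * norm x"

class complex_banach = complex_normed_vector + banach

global_interpretation complex_vector:
  vector_space "scaleC :: complex \<Rightarrow> 'a \<Rightarrow> 'a::complex_vector"
  defines csubspace = complex_vector.subspace
  by unfold_locales (simp_all add: scaleC_add_right scaleC_add_left scaleC_scaleC scaleC_one)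

definition bounded_clinear_on ::
    "'z::complex_normed_vector set \<Rightarrow> ('z \<Rightarrow> 'v::complex_normed_vector) \<Rightarrow> bool" where
  "bounded_clinear_on Y T \<longleftrightarrow>
     (\<forall>x\<in>Y. \<forall>y\<in>Y. T (x + y) = T x + T y) \<and>
     (\<forall>c. \<forall>x\<in>Y. T (c *\<^sub>C x) = c *\<^sub>C T x) \<and>
     (\<exists>K. \<forall>x\<in>Y. norm (T x) \<le> K * norm x)"

text \<open>The relative version of \<^const>\<open>onorm\<close>; as there, the point 0 contributes 0 / 0 = 0.\<close>

definition onorm_on ::
    "'z::real_normed_vector set \<Rightarrow> ('z \<Rightarrow> 'v::real_normed_vector) \<Rightarrow> real" where
  "onorm_on Y T = (SUP x\<in>Y. norm (T x) / norm x)"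

lemma onorm_on_UNIV: "onorm_on UNIV T = onorm T"
  by (simp add: onorm_on_def onorm_def)

text \<open>HOL cannot quantify over types inside a formula, so the test space \<open>Z\<close> is a type
  argument. The property of \<open>V\<close> is obtained by leaving \<open>'z\<close> a free, hence universally
  quantified, type variable.\<close>

definition one_separably_injective ::
    "'z::complex_banach itself \<Rightarrow> 'v::complex_banach itself \<Rightarrow> bool" where
  "one_separably_injective _ _ \<longleftrightarrow>
     (separable_space (euclidean :: 'z topology) \<longrightarrow>
      (\<forall>(Y::'z set) (T::'z \<Rightarrow> 'v). csubspace Y \<and> closed Y \<and> bounded_clinear_on Y T \<longrightarrow>
         (\<exists>T'::'z \<Rightarrow> 'v. bounded_clinear_on UNIV T' \<and> (\<forall>y\<in>Y. T' y = T y) \<and>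
            onorm_on UNIV T' = onorm_on Y T)))"


section \<open>C*-algebras, not necessarily unital\<close>

class cstar_algebra = complex_banach + real_normed_algebra +
  fixes star :: "'a \<Rightarrow> 'a"
  assumes scaleC_mult_left: "(c *\<^sub>C x) * y = c *\<^sub>C (x * y)"
    and scaleC_mult_right: "x * (c *\<^sub>C y) = c *\<^sub>C (x * y)"
    and star_star: "star (star x) = x"
    and star_add: "star (x + y) = star x + star y"
    and star_scaleC: "star (c *\<^sub>C x) = cnj c *\<^sub>C star x"
    and star_mult: "star (x * y) = star y * star x"
    and cstar_identity: "norm (star x * x) = (norm x)\<^sup>2"

instantiation complex :: cstar_algebra
begin

definition scaleC_complex :: "complex \<Rightarrow> complex \<Rightarrow> complex" where
  "scaleC_complex a x = a * x"

definition star_complex :: "complex \<Rightarrow> complex" where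
  "star_complex = cnj"

instance
  by standard (simp_all add: scaleC_complex_def star_complex_def algebra_simps scaleR_conv_of_real
      norm_mult power2_eq_square)

end

definition self_adjoint :: "'a::cstar_algebra set" where
  "self_adjoint = {a. star a = a}"

text \<open>The usual order: the positive elements are those of the form \<open>x\<^sup>* x\<close>.\<close>

definition cstar_le :: "'a::cstar_algebra \<Rightarrow> 'a \<Rightarrow> bool" where
  "cstar_le a b \<longleftrightarrow> (\<exists>x. b - a = star x * x)"

definition monotone_sequentially_complete :: "'a::cstar_algebra itself \<Rightarrow> bool" where
  "monotone_sequentially_complete _ \<longleftrightarrow>
     (\<forall>a::nat \<Rightarrow> 'a. range a \<subseteq> self_adjoint \<and> bounded (range a) \<and> monotone (\<le>) cstar_le a \<longrightarrow>
        (\<exists>s\<in>self_adjoint. (\<forall>n. cstar_le (a n) s) \<and>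
           (\<forall>u\<in>self_adjoint. (\<forall>n. cstar_le (a n) u) \<longrightarrow> cstar_le s u)))"

end

theory Submission
  imports Defs
begin

text \<open>
The proof is the Hahn-Banach theorem with values in an ordered space, complexified.

Let \<open>M\<close> be the norm of \<open>T\<close> on \<open>Y\<close>. Suppose that \<open>e\<close> is a positive element of \<open>A\<close> of norm at most \<open>1\<close> with
\<open>Re (T y) \<le> (M * norm y) e\<close> on \<open>Y\<close>. A real-linear extension \<open>f\<close> of \<open>Re \<circ> T\<close> that stays below \<open>(M * norm z) e\<close>
can be enlarged by one dimension as soon as some element separates the lower bounds
\<open>f y - (M * norm (y - z)) e\<close> from the upper bounds \<open>(M * norm (y + z)) e - f y\<close>. Since \<open>Z\<close> is
separable, the lower bounds have a countable dense subfamily, so a countable supremum is enough: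
this is where monotone sequential completeness enters (\<open>separating_element_exists\<close>). Zorn's lemma
gives \<open>f\<close> on all of \<open>Z\<close> (\<open>dominated_functional_exists\<close>). Separability also supplies \<open>e\<close>, which
replaces the missing unit: it is the supremum of countably many normalized elements \<open>Re (T y)\<close>, cut
off at \<open>1\<close> (\<open>countable_local_unit_exists\<close>).

The extension of \<open>T\<close> is then \<open>F x = f x - \<i> f (\<i> x)\<close>. Every rotation \<open>\<zeta> F x = F (\<zeta> x)\<close> has real part
\<open>f (\<zeta> x)\<close>, of norm at most \<open>M * norm x\<close>. In a commutative C*-algebra the norm of an element is its
numerical radius, the largest norm of the real part of a rotation of it (\<open>norm_le_if_re_parts\<close>), so
\<open>norm (F x) \<le> M * norm x\<close>.

No characters are used. The order theory is derived inside the unitization from two facts: a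
self-adjoint \<open>c\<close> of norm at most \<open>1\<close> makes \<open>1 - c\<close> a square (\<open>fixed_point_half_square\<close>), and
\<open>norm b ^ 2 \<le> norm (b ^ 2 + d ^ 2)\<close> for self-adjoint \<open>b\<close> and \<open>d\<close> (\<open>norm_le_sum_squares\<close>). Together they
identify positivity with the metric condition \<open>norm (t 1 - a) \<le> t\<close> (\<open>pos_iff_near_scalar\<close>), which is
visibly additive and closed.\<close>

section \<open>The involution and the norm\<close>

lemma star_zero [simp]: "star (0::'a::cstar_algebra) = 0"
  using star_add[of "0::'a" 0] by simp

lemma star_minus [simp]: "star (- x) = - star (x::'a::cstar_algebra)"
  using star_add[of "- x" x] by (simp add: eq_neg_iff_add_eq_0)

lemma star_diff: "star (x - y) = star x - star (y::'a::cstar_algebra)"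
  using star_add[of x "- y"] by simp

lemma star_scaleR: "star (r *\<^sub>R x) = r *\<^sub>R star (x::'a::cstar_algebra)"
  using star_scaleC[of "complex_of_real r" x] by (simp add: scaleC_of_real)

lemma norm_star [simp]: "norm (star x) = norm (x::'a::cstar_algebra)"
proof -
  have le: "norm y \<le> norm (star y)" for y :: 'a
  proof (cases "y = 0")
    case False
    have "norm y * norm y \<le> norm (star y) * norm y"
      using norm_mult_ineq[of "star y" y] by (simp add: cstar_identity power2_eq_square)
    then show ?thesis using False by simp
  qed simp
  show ?thesis using le[of x] le[of "star x"] by (simp add: star_star)
qed

lemma bounded_linear_star: "bounded_linear (star :: 'a::cstar_algebra \<Rightarrow> 'a)"
  by (rule bounded_linear_intro[where K = 1]) (simp_all add: star_add star_scaleR)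

lemma scaleC_zero_right [simp]: "c *\<^sub>C (0::'a::complex_vector) = 0"
  by (rule complex_vector.scale_zero_right)

lemma scaleC_zero_left [simp]: "0 *\<^sub>C (x::'a::complex_vector) = 0"
  by (rule complex_vector.scale_zero_left)

lemma scaleC_minus_right: "c *\<^sub>C (- x) = - (c *\<^sub>C (x::'a::complex_vector))"
  by (rule complex_vector.scale_minus_right)

lemma scaleC_minus_left: "(- c) *\<^sub>C x = - (c *\<^sub>C (x::'a::complex_vector))"
  by (rule complex_vector.scale_minus_left)

lemma scaleC_diff_right: "c *\<^sub>C (x - y) = c *\<^sub>C x - c *\<^sub>C (y::'a::complex_vector)"
  by (rule complex_vector.scale_right_diff_distrib)

lemma scaleC_scaleR: "c *\<^sub>C (r *\<^sub>R x) = r *\<^sub>R (c *\<^sub>C (x::'a::complex_vector))"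
  by (simp add: scaleC_scaleC mult.commute flip: scaleC_of_real)

lemma scaleR_scaleC: "(r *\<^sub>R c) *\<^sub>C x = r *\<^sub>R (c *\<^sub>C (x::'a::complex_vector))"
  by (simp add: scaleC_scaleC scaleR_conv_of_real flip: scaleC_of_real)

lemma bounded_linear_scaleC: "bounded_linear (\<lambda>x::'a::complex_normed_vector. c *\<^sub>C x)"
  by (rule bounded_linear_intro[where K = "cmod c"])
     (simp_all add: scaleC_add_right scaleC_scaleR norm_scaleC mult.commute)

section \<open>The unitization\<close>

datatype 'a unitization = Unitization (scal: complex) (alg: 'a)

definition left_mult :: "'a::cstar_algebra unitization \<Rightarrow> 'a \<Rightarrow> 'a" where
  "left_mult x b = scal x *\<^sub>C b + alg x * b"

lemma bounded_linear_left_mult: "bounded_linear (left_mult x)"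
  unfolding left_mult_def
  by (intro bounded_linear_add bounded_linear_scaleC bounded_linear_mult_right)

instantiation unitization :: (cstar_algebra) real_algebra_1
begin

definition "0 = Unitization 0 0"
definition "1 = Unitization 1 0"
definition "x + y = Unitization (scal x + scal y) (alg x + alg y)"
definition "- x = Unitization (- scal x) (- alg x)"
definition "x - y = Unitization (scal x - scal y) (alg x - alg y)"
definition "r *\<^sub>R x = Unitization (r *\<^sub>R scal x) (r *\<^sub>R alg x)"
definition "x * y =
  Unitization (scal x * scal y) (scal x *\<^sub>C alg y + scal y *\<^sub>C alg x + alg x * alg y)"

lemmas unitization_ops = zero_unitization_def one_unitization_def plus_unitization_def
  uminus_unitization_def minus_unitization_def scaleR_unitization_def times_unitization_def

instance
proof
  fix x y z :: "'a unitization" and r s :: real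
  show "x + y + z = x + (y + z)" "x + y = y + x" "0 + x = x" "- x + x = 0" "x - y = x + - y"
    "r *\<^sub>R (x + y) = r *\<^sub>R x + r *\<^sub>R y" "(r + s) *\<^sub>R x = r *\<^sub>R x + s *\<^sub>R x"
    "r *\<^sub>R s *\<^sub>R x = (r * s) *\<^sub>R x" "1 *\<^sub>R x = x" "(0::'a unitization) \<noteq> 1"
    by (simp_all add: unitization_ops algebra_simps)
  show "x * y * z = x * (y * z)" "(x + y) * z = x * z + y * z" "x * (y + z) = x * y + x * z"
    "1 * x = x" "x * 1 = x"
    by (simp_all add: unitization_ops scaleC_add_right scaleC_add_left scaleC_scaleC
        scaleC_mult_left scaleC_mult_right scaleC_one algebra_simps)
  show "r *\<^sub>R x * y = r *\<^sub>R (x * y)" "x * r *\<^sub>R y = r *\<^sub>R (x * y)"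
    by (simp_all add: unitization_ops scaleC_scaleC scaleR_add_right scaleR_conv_of_real
        scaleC_mult_left scaleC_mult_right algebra_simps flip: scaleC_of_real)
qed

end

lemma left_mult_add: "left_mult (x + y) = (\<lambda>b. left_mult x b + left_mult y b)"
  by (auto simp: left_mult_def unitization_ops scaleC_add_left algebra_simps)

lemma left_mult_scaleR: "left_mult (r *\<^sub>R x) = (\<lambda>b. r *\<^sub>R left_mult x b)"
  by (auto simp: left_mult_def unitization_ops scaleR_scaleC scaleR_add_right)

lemma left_mult_times: "left_mult (x * y) = left_mult x \<circ> left_mult y"
  by (auto simp: left_mult_def unitization_ops scaleC_add_right scaleC_scaleC scaleC_mult_left
      scaleC_mult_right algebra_simps)

lemma left_mult_one: "left_mult 1 = (\<lambda>b. b)"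
  by (auto simp: left_mult_def unitization_ops scaleC_one)

text \<open>The operator seminorm of \<open>left_mult\<close> is faithful on the elements with scalar part \<open>0\<close>, but if the
algebra already has a unit \<open>u\<close>, then \<open>1 - u\<close> acts as zero. The norm of the unitization is therefore the
maximum of this seminorm and the modulus of the scalar part, both of which satisfy the C*-identity.\<close>

lemma alg_eq_zero_if_left_mult:
  assumes "onorm (left_mult x) = 0" "scal x = 0" shows "alg x = 0"
proof -
  have "left_mult x (star (alg x)) = 0"
    using assms(1) onorm_eq_0[OF bounded_linear_left_mult] by blast
  then have "star (star (alg x)) * star (alg x) = 0"
    by (simp add: left_mult_def assms(2) star_star)
  then show ?thesis using cstar_identity[of "star (alg x)"] by simp
qed

instantiation unitization :: (cstar_algebra) real_normed_algebra_1
begin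

definition norm_unitization_def:
  "norm (x :: 'a unitization) = max (cmod (scal x)) (onorm (left_mult x))"
definition dist_unitization_def: "dist (x :: 'a unitization) y = norm (x - y)"
definition sgn_unitization_def: "sgn (x :: 'a unitization) = x /\<^sub>R norm x"
definition uniformity_unitization_def:
  "uniformity = (INF e\<in>{0 <..}. principal {(x :: 'a unitization, y). dist x y < e})"
definition open_unitization_def:
  "open (U :: 'a unitization set) =
    (\<forall>x\<in>U. eventually (\<lambda>(x', y). x' = x \<longrightarrow> y \<in> U) uniformity)"

instance
proof
  fix x y :: "'a unitization" and r :: real
  show "dist x y = norm (x - y)" by (rule dist_unitization_def)
  show "sgn x = x /\<^sub>R norm x" by (rule sgn_unitization_def)
  show "uniformity = (INF e\<in>{0 <..}. principal {(x::'a unitization, y). dist x y < e})"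
    by (rule uniformity_unitization_def)
  show "open U = (\<forall>x\<in>U. eventually (\<lambda>(x', y). x' = x \<longrightarrow> y \<in> U) uniformity)"
    for U :: "'a unitization set"
    by (rule open_unitization_def)
  show "(norm x = 0) = (x = 0)"
  proof
    assume "norm x = 0"
    then have "cmod (scal x) \<le> 0" "onorm (left_mult x) \<le> 0"
      by (metis norm_unitization_def max.cobounded1, metis norm_unitization_def max.cobounded2)
    then have "scal x = 0" "onorm (left_mult x) = 0"
      using onorm_pos_le[OF bounded_linear_left_mult[of x]] by auto
    then show "x = 0"
      using alg_eq_zero_if_left_mult[of x] by (cases x) (simp add: unitization_ops)
  next
    assume "x = 0"
    then have "left_mult x = (\<lambda>b. 0)" "scal x = 0"
      by (auto simp: left_mult_def unitization_ops)
    then show "norm x = 0" by (simp add: norm_unitization_def onorm_zero)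
  qed
  have "cmod (scal (x + y)) \<le> cmod (scal x) + cmod (scal y)"
    by (simp add: unitization_ops norm_triangle_ineq)
  moreover have "onorm (left_mult (x + y)) \<le> onorm (left_mult x) + onorm (left_mult y)"
    unfolding left_mult_add by (intro onorm_triangle bounded_linear_left_mult)
  ultimately show "norm (x + y) \<le> norm x + norm y"
    unfolding norm_unitization_def by linarith
  show "norm (r *\<^sub>R x) = \<bar>r\<bar> * norm x"
    by (simp add: norm_unitization_def left_mult_scaleR onorm_scaleR[OF bounded_linear_left_mult]
        max_mult_distrib_left) (simp add: unitization_ops)
  have "cmod (scal (x * y)) \<le> norm x * norm y"
    by (auto simp: unitization_ops norm_mult norm_unitization_def le_max_iff_disj
        intro!: mult_mono)
  moreover have "onorm (left_mult (x * y)) \<le> norm x * norm y"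
    unfolding left_mult_times
    by (rule order_trans[OF onorm_compose[OF bounded_linear_left_mult bounded_linear_left_mult]],
        rule mult_mono)
       (auto simp: norm_unitization_def le_max_iff_disj onorm_pos_le bounded_linear_left_mult)
  ultimately show "norm (x * y) \<le> norm x * norm y"
    unfolding norm_unitization_def[of "x * y"] by simp
  show "norm (1::'a unitization) = 1"
    using onorm_id_le[where 'a = 'a]
    by (simp add: norm_unitization_def left_mult_one) (simp add: unitization_ops)
qed

end

instantiation unitization :: (cstar_algebra) cstar_algebra
begin

definition "c *\<^sub>C x = Unitization (c * scal x) (c *\<^sub>C alg x)"
definition "star x = Unitization (cnj (scal x)) (star (alg x))"

text \<open>This identity carries the C*-identity of the algebra over to the operator seminorm.\<close>

lemma left_mult_star: "star (left_mult x b) * left_mult x b = star b * left_mult (star x * x) b"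
  by (simp add: left_mult_def star_unitization_def unitization_ops star_add star_mult star_scaleC
      scaleC_mult_left scaleC_mult_right scaleC_add_right scaleC_scaleC algebra_simps)

lemma onorm_left_mult_le: "(onorm (left_mult x))\<^sup>2 \<le> onorm (left_mult (star x * x))"
proof -
  let ?K = "onorm (left_mult (star x * x))"
  have K: "0 \<le> ?K" by (rule onorm_pos_le[OF bounded_linear_left_mult])
  have "norm (left_mult x b) \<le> sqrt ?K * norm b" for b
  proof (rule power2_le_imp_le)
    have "(norm (left_mult x b))\<^sup>2 = norm (star b * left_mult (star x * x) b)"
      by (metis left_mult_star cstar_identity)
    also have "\<dots> \<le> norm b * norm (left_mult (star x * x) b)"
      using norm_mult_ineq[of "star b"] by simp
    also have "\<dots> \<le> norm b * (?K * norm b)"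
      by (intro mult_left_mono onorm[OF bounded_linear_left_mult]) simp
    also have "\<dots> = (sqrt ?K * norm b)\<^sup>2"
      using K by (simp add: power_mult_distrib) (simp add: power2_eq_square)
    finally show "(norm (left_mult x b))\<^sup>2 \<le> (sqrt ?K * norm b)\<^sup>2" .
  qed (use K in auto)
  then have "onorm (left_mult x) \<le> sqrt ?K"
    by (intro onorm_bound) (use K in auto)
  then show ?thesis
    using K onorm_pos_le[OF bounded_linear_left_mult[of x]]
    by (metis real_sqrt_ge_0_iff power_mono real_sqrt_pow2)
qed

lemma onorm_left_mult_star: "onorm (left_mult (star x * x)) = (onorm (left_mult x))\<^sup>2"
proof -
  have le: "onorm (left_mult (star y * y)) \<le> onorm (left_mult (star y)) * onorm (left_mult y)"
    for y :: "'a unitization"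
    unfolding left_mult_times by (intro onorm_compose bounded_linear_left_mult)
  have le': "onorm (left_mult y) \<le> onorm (left_mult (star y))" for y :: "'a unitization"
  proof (cases "onorm (left_mult y) = 0")
    case True then show ?thesis by (simp add: onorm_pos_le[OF bounded_linear_left_mult])
  next
    case False
    then have "onorm (left_mult y) > 0"
      using onorm_pos_le[OF bounded_linear_left_mult[of y]] by simp
    moreover have "onorm (left_mult y) * onorm (left_mult y)
        \<le> onorm (left_mult (star y)) * onorm (left_mult y)"
      using order_trans[OF onorm_left_mult_le le] by (simp only: power2_eq_square)
    ultimately show ?thesis by (rule mult_right_le_imp_le[rotated])
  qed
  have "star (star x) = x" by (simp add: star_unitization_def star_star)
  then have "onorm (left_mult (star x)) = onorm (left_mult x)"
    using le'[of x] le'[of "star x"] by simp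
  then show ?thesis
    using le[of x] onorm_left_mult_le[of x] by (simp add: power2_eq_square)
qed

lemma norm_scal_le: "cmod (scal x) \<le> norm (x::'a unitization)"
  by (simp add: norm_unitization_def)

text \<open>Together with \<open>norm_scal_le\<close> and \<open>norm_unitization_le\<close> this makes the norm equivalent to the sum of the
norms of the components, whence completeness.\<close>

lemma norm_alg_le: "norm (alg x) \<le> 2 * norm (x::'a unitization)"
proof (cases "alg x = 0")
  case False
  let ?a = "alg x"
  have "norm ?a * norm ?a = norm (?a * star ?a)"
    using cstar_identity[of "star ?a"] by (simp add: star_star power2_eq_square)
  also have "\<dots> = norm (left_mult x (star ?a) - scal x *\<^sub>C star ?a)"
    by (simp add: left_mult_def)
  also have "\<dots> \<le> norm (left_mult x (star ?a)) + norm (scal x *\<^sub>C star ?a)"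
    by (rule norm_triangle_ineq4)
  also have "\<dots> \<le> norm x * norm ?a + norm x * norm ?a"
  proof (rule add_mono)
    have "norm (left_mult x (star ?a)) \<le> onorm (left_mult x) * norm ?a"
      using onorm[OF bounded_linear_left_mult, of x "star ?a"] by simp
    also have "\<dots> \<le> norm x * norm ?a" by (intro mult_right_mono) (auto simp: norm_unitization_def)
    finally show "norm (left_mult x (star ?a)) \<le> norm x * norm ?a" .
    show "norm (scal x *\<^sub>C star ?a) \<le> norm x * norm ?a"
      by (simp add: norm_scaleC mult_right_mono norm_scal_le)
  qed
  finally show ?thesis using False by (simp flip: distrib_right)
qed simp

lemma norm_unitization_le: "norm x \<le> cmod (scal x) + norm (alg (x::'a unitization))"
proof -
  have "onorm (left_mult x) \<le> cmod (scal x) + norm (alg x)"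
  proof (rule onorm_bound)
    fix b
    have "norm (left_mult x b) \<le> norm (scal x *\<^sub>C b) + norm (alg x * b)"
      unfolding left_mult_def by (rule norm_triangle_ineq)
    also have "\<dots> \<le> (cmod (scal x) + norm (alg x)) * norm b"
      by (simp add: norm_scaleC norm_mult_ineq distrib_right)
    finally show "norm (left_mult x b) \<le> (cmod (scal x) + norm (alg x)) * norm b" .
  qed simp
  then show ?thesis by (simp add: norm_unitization_def)
qed

instance
proof
  fix x y :: "'a unitization" and c d :: complex and r :: real
  show "c *\<^sub>C (x + y) = c *\<^sub>C x + c *\<^sub>C y" "(c + d) *\<^sub>C x = c *\<^sub>C x + d *\<^sub>C x"
    "c *\<^sub>C d *\<^sub>C x = (c * d) *\<^sub>C x" "1 *\<^sub>C x = x" "complex_of_real r *\<^sub>C x = r *\<^sub>R x"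
    by (simp_all add: scaleC_unitization_def unitization_ops scaleC_add_right scaleC_add_left
        scaleC_scaleC scaleC_one scaleC_of_real algebra_simps scaleR_conv_of_real)
  show "c *\<^sub>C x * y = c *\<^sub>C (x * y)" "x * c *\<^sub>C y = c *\<^sub>C (x * y)"
    by (simp_all add: scaleC_unitization_def unitization_ops scaleC_add_right
        scaleC_scaleC scaleC_mult_left scaleC_mult_right algebra_simps)
  show "star (star x) = x" "star (x + y) = star x + star y" "star (c *\<^sub>C x) = cnj c *\<^sub>C star x"
    "star (x * y) = star y * star x"
    by (simp_all add: scaleC_unitization_def star_unitization_def unitization_ops star_star star_add
        star_scaleC star_mult algebra_simps)
  show "norm (c *\<^sub>C x) = cmod c * norm x"
  proof -
    have le: "norm (c *\<^sub>C x) \<le> cmod c * norm x" for c and x :: "'a unitization"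
    proof -
      have "left_mult (c *\<^sub>C x) = (\<lambda>b. c *\<^sub>C left_mult x b)"
        by (auto simp: left_mult_def scaleC_unitization_def scaleC_add_right scaleC_scaleC
            scaleC_mult_left)
      moreover have "onorm (\<lambda>b. c *\<^sub>C left_mult x b) \<le> cmod c * onorm (left_mult x)"
        by (rule onorm_bound)
           (auto simp: norm_scaleC mult.assoc onorm_pos_le[OF bounded_linear_left_mult]
            intro!: mult_left_mono onorm[OF bounded_linear_left_mult])
      ultimately show ?thesis
        by (simp add: norm_unitization_def max_mult_distrib_left norm_mult)
           (simp add: scaleC_unitization_def norm_mult le_max_iff_disj)
    qed
    show ?thesis
    proof (cases "c = 0")
      case False
      have "inverse c *\<^sub>C (c *\<^sub>C x) = x"
        using False by (cases x) (simp add: scaleC_unitization_def scaleC_scaleC scaleC_one)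
      then have "norm x \<le> inverse (cmod c) * norm (c *\<^sub>C x)"
        using le[of "inverse c" "c *\<^sub>C x"] by (simp add: norm_inverse)
      then have "cmod c * norm x \<le> norm (c *\<^sub>C x)"
        using False by (simp add: field_simps)
      then show ?thesis using le[of c x] by simp
    qed (use le[of 0 x] in simp)
  qed
  show "norm (star x * x) = (norm x)\<^sup>2"
  proof -
    have "cmod (scal (star x * x)) = (cmod (scal x))\<^sup>2"
      by (simp add: star_unitization_def unitization_ops norm_mult power2_eq_square)
    then show ?thesis
      using onorm_pos_le[OF bounded_linear_left_mult[of x]]
      by (auto simp: norm_unitization_def onorm_left_mult_star max_def power_mono
          dest: power2_le_imp_le)
  qed
next
  fix X :: "nat \<Rightarrow> 'a unitization"
  assume X: "Cauchy X"
  have [simp]: "scal (x - y) = scal x - scal y" "alg (x - y) = alg x - alg y"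
    for x y :: "'a unitization" by (simp_all add: unitization_ops)
  have "Cauchy (\<lambda>n. scal (X n))"
  proof (rule metric_CauchyI)
    fix e :: real assume "e > 0"
    then show "\<exists>M. \<forall>m\<ge>M. \<forall>n\<ge>M. dist (scal (X m)) (scal (X n)) < e"
      using metric_CauchyD[OF X, of e] norm_scal_le[where x = "X m - X n" for m n]
      by (simp add: dist_norm) (meson order_le_less_trans)
  qed
  then obtain s where s: "(\<lambda>n. scal (X n)) \<longlonglongrightarrow> s" using Cauchy_convergent convergent_def by blast
  have "Cauchy (\<lambda>n. alg (X n))"
  proof (rule metric_CauchyI)
    fix e :: real assume "e > 0"
    then obtain M where M: "\<forall>m\<ge>M. \<forall>n\<ge>M. dist (X m) (X n) < e / 2"
      using metric_CauchyD[OF X, of "e / 2"] by auto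
    show "\<exists>M. \<forall>m\<ge>M. \<forall>n\<ge>M. dist (alg (X m)) (alg (X n)) < e"
    proof (intro exI allI impI)
      fix m n assume "m \<ge> M" "n \<ge> M"
      then have "norm (X m - X n) < e / 2" using M by (simp add: dist_norm)
      then show "dist (alg (X m)) (alg (X n)) < e"
        using norm_alg_le[of "X m - X n"] by (simp add: dist_norm)
    qed
  qed
  then obtain a where a: "(\<lambda>n. alg (X n)) \<longlonglongrightarrow> a" using Cauchy_convergent convergent_def by blast
  have "X \<longlonglongrightarrow> Unitization s a"
  proof (rule iffD2[OF tendsto_dist_iff], rule tendsto_sandwich)
    show "\<forall>\<^sub>F n in sequentially. 0 \<le> dist (X n) (Unitization s a)" by simp
    show "\<forall>\<^sub>F n in sequentially. dist (X n) (Unitization s a)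
        \<le> dist (scal (X n)) s + dist (alg (X n)) a"
    proof (rule always_eventually, rule allI)
      fix n
      show "dist (X n) (Unitization s a) \<le> dist (scal (X n)) s + dist (alg (X n)) a"
        using norm_unitization_le[of "X n - Unitization s a"] by (simp add: dist_norm)
    qed
    show "(\<lambda>n. dist (scal (X n)) s + dist (alg (X n)) a) \<longlonglongrightarrow> 0"
      by (rule tendsto_add_zero) (use s a in \<open>auto intro: tendsto_dist_iff[THEN iffD1]\<close>)
  qed simp
  then show "convergent X" by (auto simp: convergent_def)
qed

end

abbreviation embed :: "'a::cstar_algebra \<Rightarrow> 'a unitization" where
  "embed \<equiv> Unitization 0"

lemma embed_ops:
  "embed (a + b) = embed a + embed b" "embed (a - b) = embed a - embed b"
  "embed (a * b) = embed a * embed b" "embed (- a) = - embed a" "embed 0 = 0"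
  "embed (r *\<^sub>R a) = r *\<^sub>R embed a" "embed (c *\<^sub>C a) = c *\<^sub>C embed a"
  "embed (star a) = star (embed a)"
  by (simp_all add: unitization_ops scaleC_unitization_def star_unitization_def)

text \<open>Testing left multiplication by \<open>a\<close> on \<open>star a\<close> gives the lower bound.\<close>

lemma norm_embed [simp]: "norm (embed a) = norm a"
proof (rule antisym)
  show "norm (embed a) \<le> norm a" using norm_unitization_le[of "embed a"] by simp
  have *: "left_mult (embed a) (star a) = a * star a" by (simp add: left_mult_def)
  have "norm a * norm a = norm (left_mult (embed a) (star a))"
    using cstar_identity[of "star a"] unfolding * by (simp add: star_star power2_eq_square)
  also have "\<dots> \<le> onorm (left_mult (embed a)) * norm a"
    using onorm[OF bounded_linear_left_mult, of "embed a" "star a"] by simp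
  finally have "norm a \<le> onorm (left_mult (embed a)) \<or> a = 0" by auto
  then show "norm a \<le> norm (embed a)" by (auto simp: norm_unitization_def)
qed

lemma unitization_commute:
  assumes "\<forall>x y :: 'a::cstar_algebra. x * y = y * x"
  shows "x * y = y * (x :: 'a unitization)"
  using assms by (simp add: unitization_ops algebra_simps)

section \<open>Positivity in commutative unital algebras\<close>

notation cstar_le (infix "\<preceq>" 50)

lemma cstar_le_iff_diff: "a \<preceq> b \<longleftrightarrow> 0 \<preceq> b - a"
  by (simp add: cstar_le_def)

lemma cstar_le_cong_diff: "b - a = d - c \<Longrightarrow> a \<preceq> b \<longleftrightarrow> c \<preceq> d"
  by (simp add: cstar_le_def)

lemma cstar_le_refl: "a \<preceq> a"
  by (auto simp: cstar_le_def intro: exI[of _ 0])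

lemma star_pos: "0 \<preceq> a \<Longrightarrow> star a = a"
  by (auto simp: cstar_le_def star_mult star_star)

lemma square_pos: "star b = b \<Longrightarrow> 0 \<preceq> b * b"
  by (auto simp: cstar_le_def intro!: exI[of _ b])

lemma norm_square:
  "star b = b \<Longrightarrow> norm (b * b) = (norm b)\<^sup>2" for b :: "'a::cstar_algebra"
  using cstar_identity[of b] by simp

lemma scaleR_pos:
  assumes "0 \<le> r" "0 \<preceq> a"
  shows "0 \<preceq> r *\<^sub>R a"
proof -
  obtain x where "a = star x * x" using assms(2) by (auto simp: cstar_le_def)
  then have "r *\<^sub>R a = star (sqrt r *\<^sub>R x) * (sqrt r *\<^sub>R x)"
    using assms(1) by (simp add: star_scaleR)
  then show ?thesis unfolding cstar_le_def by (intro exI) (simp only: diff_0_right)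
qed

lemma star_one [simp]: "star (1::'a::{cstar_algebra,real_normed_algebra_1}) = 1"
  by (metis star_mult star_star mult_1_right)

definition re_part :: "'a::cstar_algebra \<Rightarrow> 'a" where
  "re_part x = (1/2) *\<^sub>R (x + star x)"

definition im_part :: "'a::cstar_algebra \<Rightarrow> 'a" where
  "im_part x = re_part (- \<i> *\<^sub>C x)"

lemma star_re_part [simp]: "star (re_part x) = re_part x"
  by (simp add: re_part_def star_scaleR star_add star_star add.commute)

lemma star_im_part [simp]: "star (im_part x) = im_part x"
  by (simp add: im_part_def)

lemma norm_re_part: "norm (re_part x) \<le> norm x"
  using norm_triangle_ineq[of x "star x"] by (simp add: re_part_def)

lemma norm_im_part: "norm (im_part x) \<le> norm x"
  using norm_re_part[of "- \<i> *\<^sub>C x"] by (simp add: im_part_def norm_scaleC)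

lemma re_im_part: "x = re_part x + \<i> *\<^sub>C im_part x"
proof -
  have "\<i> *\<^sub>C im_part x = (1/2) *\<^sub>R (x - star x)"
    by (simp add: im_part_def re_part_def star_scaleC scaleC_scaleR scaleC_add_right
        scaleC_scaleC scaleC_minus_left scaleC_one scaleC_diff_right)
  then show ?thesis
    by (simp add: re_part_def flip: scaleR_add_right)
qed

context
  assumes comm: "\<And>x y :: 'a::{cstar_algebra,real_normed_algebra_1}. x * y = y * x"
begin

lemma left_comm: "x * (y * z) = y * (x * z)" for x y z :: 'a
  by (metis comm mult.assoc)

lemmas comm_simps = algebra_simps comm left_comm

lemma star_times_self_add_imaginary:
  fixes b d :: 'a
  assumes "star b = b" "star d = d"
  shows "star (b + \<i> *\<^sub>C d) * (b + \<i> *\<^sub>C d) = b * b + d * d"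
  using assms
  by (simp add: star_add star_scaleC scaleC_mult_left scaleC_mult_right scaleC_scaleC
      scaleC_minus_left scaleC_one comm_simps)

text \<open>In function algebras this is \<open>b\<^sup>2 \<le> b\<^sup>2 + d\<^sup>2\<close>. It needs no order: \<open>b\<close> is the real part of
\<open>b + \<i> d\<close>, whose squared norm is the right-hand side by commutativity and the C*-identity.\<close>

lemma norm_le_sum_squares:
  fixes b d :: 'a
  assumes "star b = b" "star d = d"
  shows "(norm b)\<^sup>2 \<le> norm (b * b + d * d)"
proof -
  define u where "u = b + \<i> *\<^sub>C d"
  have "re_part u = b"
    using assms by (simp add: u_def re_part_def star_add star_scaleC scaleC_minus_left flip: scaleR_2)
  then have "norm b \<le> norm u" using norm_re_part[of u] by simp
  then have "(norm b)\<^sup>2 \<le> (norm u)\<^sup>2" by (intro power_mono) simp_all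
  then show ?thesis
    using cstar_identity[of u] star_times_self_add_imaginary[OF assms] by (simp add: u_def)
qed

text \<open>The fixed point is \<open>1 - sqrt (1 - c)\<close>. At \<open>norm c = 1\<close> the iteration is not a contraction; instead each of
its steps is dominated by the step of the same iteration for the number \<open>1\<close>, which increases to \<open>1\<close>.\<close>

lemma fixed_point_half_square:
  fixes c :: 'a
  assumes c: "star c = c" "norm c \<le> 1"
  shows "\<exists>x. star x = x \<and> norm x \<le> 1 \<and> x = (1/2) *\<^sub>R (c + x * x)"
proof -
  define X where "X = rec_nat 0 (\<lambda>_ x. (1/2) *\<^sub>R (c + x * x))"
  define r :: "nat \<Rightarrow> real" where "r = rec_nat 0 (\<lambda>_ t. (1 + t * t) / 2)"
  have X_0: "X 0 = 0" and X_Suc: "X (Suc k) = (1/2) *\<^sub>R (c + X k * X k)" for k by (simp_all add: X_def)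
  have r_0: "r 0 = 0" and r_Suc: "r (Suc k) = (1 + r k * r k) / 2" for k by (simp_all add: r_def)
  note [simp] = X_0 X_Suc r_0 r_Suc
  have r01: "0 \<le> r k \<and> r k \<le> 1" for k
    by (induction k) (simp_all add: mult_le_one)
  have r_mono: "r k \<le> r (Suc k)" for k
    using zero_le_power2[of "r k - 1"] by (simp add: power2_eq_square algebra_simps)
  have starX: "star (X k) = X k" for k
    by (induction k) (simp_all add: star_scaleR star_add star_mult c)
  have normX: "norm (X k) \<le> r k" for k
  proof (induction k)
    case (Suc k)
    have "norm (c + X k * X k) \<le> norm c + norm (X k) * norm (X k)"
      using norm_triangle_ineq[of c "X k * X k"] norm_mult_ineq[of "X k" "X k"] by linarith
    also have "\<dots> \<le> 1 + r k * r k" using c Suc by (intro add_mono mult_mono) (simp_all add: r01)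
    finally show ?case by simp
  qed simp
  have step: "norm (X (Suc k) - X k) \<le> r (Suc k) - r k" for k
  proof (induction k)
    case 0 then show ?case using c by simp
  next
    case (Suc k)
    have "X (Suc (Suc k)) - X (Suc k)
        = (1/2) *\<^sub>R (c + X (Suc k) * X (Suc k)) - (1/2) *\<^sub>R (c + X k * X k)"
      by (simp only: X_Suc)
    also have "\<dots> = (1/2) *\<^sub>R ((X (Suc k) - X k) * (X (Suc k) + X k))"
      by (simp add: comm_simps del: X_Suc)
    finally have "norm (X (Suc (Suc k)) - X (Suc k))
        = (1/2) * norm ((X (Suc k) - X k) * (X (Suc k) + X k))" by simp
    also have "\<dots> \<le> (1/2) * (norm (X (Suc k) - X k) * norm (X (Suc k) + X k))"
      by (intro mult_left_mono norm_mult_ineq) simp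
    \<comment> \<open>Both factors are majorized, the first by the induction hypothesis.\<close>
    also have "\<dots> \<le> (1/2) * ((r (Suc k) - r k) * (r (Suc k) + r k))"
      by (intro mult_left_mono mult_mono Suc norm_triangle_le add_mono normX)
         (use r_mono[of k] in simp_all)
    also have "\<dots> = r (Suc (Suc k)) - r (Suc k)"
      unfolding r_Suc[of "Suc k"] by (subst (3) r_Suc) (simp add: field_simps del: r_Suc)
    finally show ?case .
  qed
  have "incseq r" by (rule incseq_SucI) (rule r_mono)
  then have "convergent r"
    using r01 by (auto intro: incseq_convergent[of r 1] simp: convergent_def)
  then have "Cauchy r" by (rule convergent_Cauchy)
  have dist_le: "dist (X m) (X n) \<le> dist (r m) (r n)" for m n
  proof -
    have *: "dist (X (k + j)) (X k) \<le> r (k + j) - r k" for k j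
    proof (induction j)
      case (Suc j)
      then show ?case
        using step[of "k + j"] dist_triangle[of "X (k + Suc j)" "X k" "X (k + j)"]
        by (simp add: dist_norm del: X_Suc r_Suc)
    qed simp
    show ?thesis
    proof (cases "n \<le> m")
      case True then show ?thesis using *[of n "m - n"] by (simp add: dist_real_def)
    next
      case False then show ?thesis using *[of m "n - m"] by (simp add: dist_commute dist_real_def)
    qed
  qed
  have "Cauchy X"
    using metric_CauchyD[OF \<open>Cauchy r\<close>] dist_le by (intro metric_CauchyI) (meson order_le_less_trans)
  then obtain x where x: "X \<longlonglongrightarrow> x" using Cauchy_convergent convergent_def by blast
  have "(\<lambda>k. star (X k)) \<longlonglongrightarrow> star x" by (rule bounded_linear.tendsto[OF bounded_linear_star x])
  then have "star x = x" using x starX LIMSEQ_unique by simp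
  moreover have "norm x \<le> 1"
    using normX r01 by (intro LIMSEQ_le_const2[OF tendsto_norm[OF x]]) (meson order_trans)
  moreover have "(\<lambda>k. X (Suc k)) \<longlonglongrightarrow> (1/2) *\<^sub>R (c + x * x)"
    by (simp, intro tendsto_intros x)
  then have "x = (1/2) *\<^sub>R (c + x * x)" using LIMSEQ_Suc[OF x] LIMSEQ_unique by blast
  ultimately show ?thesis by blast
qed

text \<open>With \<open>a = t (1 - c)\<close>, the root is \<open>sqrt t (1 - x)\<close> for the fixed point \<open>x\<close> belonging to \<open>c\<close>. That the
root is again near a scalar makes it positive, which \<open>abs_exists\<close> relies on.\<close>

lemma sqrt_near_scalar:
  fixes a :: 'a
  assumes a: "star a = a" and t: "norm (t *\<^sub>R 1 - a) \<le> t"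
  shows "\<exists>s. star s = s \<and> s * s = a \<and> norm (sqrt t *\<^sub>R 1 - s) \<le> sqrt t"
proof (cases "t = 0")
  case True
  then show ?thesis using t by (intro exI[of _ 0]) simp
next
  case False
  then have "t > 0" using t norm_ge_zero[of "t *\<^sub>R 1 - a"] by linarith
  define c where "c = 1 - (1/t) *\<^sub>R a"
  have "c = (1/t) *\<^sub>R (t *\<^sub>R 1 - a)" using \<open>t > 0\<close> by (simp add: c_def scaleR_diff_right)
  then have "norm c \<le> 1" using t \<open>t > 0\<close> by simp
  moreover have "star c = c" by (simp add: c_def star_diff star_scaleR a)
  ultimately obtain x where x: "star x = x" "norm x \<le> 1" "x = (1/2) *\<^sub>R (c + x * x)"
    using fixed_point_half_square by blast
  from arg_cong[OF x(3), of "scaleR 2"] have x2: "2 *\<^sub>R x = c + x * x" by simp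
  define s where "s = sqrt t *\<^sub>R (1 - x)"
  have "s * s = t *\<^sub>R ((1 - x) * (1 - x))" using \<open>t > 0\<close> by (simp add: s_def)
  also have "(1 - x) * (1 - x) = 1 - (2 *\<^sub>R x - x * x)" by (simp add: algebra_simps scaleR_2)
  also have "\<dots> = (1/t) *\<^sub>R a" unfolding x2 by (simp add: c_def)
  finally have "s * s = a" using \<open>t > 0\<close> by simp
  moreover have "norm (sqrt t *\<^sub>R 1 - s) \<le> sqrt t"
    using x(2) \<open>t > 0\<close> by (simp add: s_def scaleR_diff_right)
  moreover have "star s = s" by (simp add: s_def star_scaleR star_diff x(1))
  ultimately show ?thesis by blast
qed

text \<open>Conversely to \<open>sqrt_near_scalar\<close>, \<open>r\<^sup>2 - b\<^sup>2\<close> has a self-adjoint root \<open>s\<close>, and \<open>s\<^sup>2 + b\<^sup>2 = r\<^sup>2\<close> bounds the norm of \<open>s\<close>.\<close>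

lemma norm_scalar_diff_square:
  fixes b :: 'a
  assumes b: "star b = b" "norm b \<le> r"
  shows "norm (r\<^sup>2 *\<^sub>R 1 - b * b) \<le> r\<^sup>2"
proof -
  have "r \<ge> 0" using b norm_ge_zero order_trans by blast
  define a where "a = r\<^sup>2 *\<^sub>R 1 - b * b"
  have "norm (r\<^sup>2 *\<^sub>R 1 - a) \<le> r\<^sup>2"
    using b by (simp add: a_def norm_square power_mono)
  moreover have "star a = a" by (simp add: a_def star_diff star_scaleR star_mult b)
  ultimately obtain s where s: "star s = s" "s * s = a" using sqrt_near_scalar by blast
  have "(norm s)\<^sup>2 \<le> norm (s * s + b * b)" by (rule norm_le_sum_squares[OF s(1) b(1)])
  then show ?thesis using s by (simp add: a_def flip: norm_square[OF s(1)])
qed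

text \<open>By commutativity \<open>star x * x\<close> is the sum of the squares of the real and imaginary parts of \<open>x\<close>; both
squares are near a scalar, hence so is their sum.\<close>

lemma pos_sqrt_exists:
  fixes a :: 'a
  assumes "0 \<preceq> a"
  shows "\<exists>s. star s = s \<and> s * s = a"
proof -
  obtain x where x: "a = star x * x" using assms by (auto simp: cstar_le_def)
  define p q where "p = re_part x" and "q = im_part x"
  have a: "a = p * p + q * q"
    using star_times_self_add_imaginary[of p q] re_im_part[of x] by (simp add: x p_def q_def)
  let ?r = "(norm x)\<^sup>2"
  have "norm (?r *\<^sub>R 1 - p * p) \<le> ?r" "norm (?r *\<^sub>R 1 - q * q) \<le> ?r"
    by (rule norm_scalar_diff_square; simp add: p_def q_def norm_re_part norm_im_part)+
  moreover have "(2 * ?r) *\<^sub>R 1 - a = (?r *\<^sub>R 1 - p * p) + (?r *\<^sub>R 1 - q * q)"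
    by (simp add: a algebra_simps flip: scaleR_2)
  ultimately have "norm ((2 * ?r) *\<^sub>R 1 - a) \<le> 2 * ?r"
    by (simp only:) (rule norm_triangle_le, linarith)
  then show ?thesis using sqrt_near_scalar star_pos[OF assms] by blast
qed

text \<open>Kelley and Vaught's description of the positive cone. It turns sums and limits of positive elements
into estimates of norms; the freedom in \<open>t\<close> lets one \<open>t\<close> serve a whole convergent sequence.\<close>

lemma pos_iff_near_scalar:
  fixes a :: 'a
  assumes "norm a \<le> t"
  shows "0 \<preceq> a \<longleftrightarrow> star a = a \<and> norm (t *\<^sub>R 1 - a) \<le> t"
proof
  assume "0 \<preceq> a"
  then obtain s where s: "star s = s" "s * s = a" using pos_sqrt_exists by blast
  have t0: "t \<ge> 0" using assms norm_ge_zero order_trans by blast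
  have "(norm s)\<^sup>2 \<le> t" using assms norm_square[OF s(1)] s(2) by simp
  then have "norm s \<le> sqrt t" by (rule real_le_rsqrt)
  from norm_scalar_diff_square[OF s(1) this] show "star a = a \<and> norm (t *\<^sub>R 1 - a) \<le> t"
    using s star_pos[OF \<open>0 \<preceq> a\<close>] t0 by simp
next
  assume "star a = a \<and> norm (t *\<^sub>R 1 - a) \<le> t"
  then obtain s where "star s = s" "s * s = a" using sqrt_near_scalar by blast
  then show "0 \<preceq> a" using square_pos by blast
qed

lemma pos_add:
  fixes a b :: 'a
  assumes "0 \<preceq> a" "0 \<preceq> b"
  shows "0 \<preceq> a + b"
proof -
  let ?s = "norm a" and ?t = "norm b"
  have "norm (?s *\<^sub>R 1 - a) \<le> ?s" "norm (?t *\<^sub>R 1 - b) \<le> ?t"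
    using assms pos_iff_near_scalar by blast+
  moreover have "(?s + ?t) *\<^sub>R 1 - (a + b) = (?s *\<^sub>R 1 - a) + (?t *\<^sub>R 1 - b)"
    by (simp add: algebra_simps)
  ultimately have "norm ((?s + ?t) *\<^sub>R 1 - (a + b)) \<le> ?s + ?t"
    by (simp only:) (rule norm_triangle_le, linarith)
  then show ?thesis
    using pos_iff_near_scalar[OF norm_triangle_ineq] assms by (simp add: star_add star_pos)
qed

lemma unital_le_trans: "a \<preceq> b \<Longrightarrow> b \<preceq> c \<Longrightarrow> a \<preceq> c" for a b c :: 'a
  using pos_add[of "b - a" "c - b"] by (simp add: cstar_le_iff_diff[of a] cstar_le_iff_diff[of b])

lemma closed_pos: "closed {a::'a. 0 \<preceq> a}"
proof (unfold closed_sequential_limits, intro allI impI, elim conjE)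
  fix X :: "nat \<Rightarrow> 'a" and a
  assume X: "\<forall>n. X n \<in> {a. 0 \<preceq> a}" and lim: "X \<longlonglongrightarrow> a"
  obtain t where t: "\<And>n. norm (X n) \<le> t"
    using Bseq_def convergent_imp_Bseq[of X] lim unfolding convergent_def by metis
  have "(\<lambda>n. star (X n)) \<longlonglongrightarrow> star a" by (rule bounded_linear.tendsto[OF bounded_linear_star lim])
  moreover have "(\<lambda>n. star (X n)) = X" using X by (simp add: star_pos)
  ultimately have "star a = a" using lim LIMSEQ_unique[of X] by simp
  moreover have "norm a \<le> t" using t LIMSEQ_le_const2[OF tendsto_norm[OF lim]] by blast
  moreover have "norm (t *\<^sub>R 1 - a) \<le> t"
  proof (rule LIMSEQ_le_const2[OF tendsto_norm])
    show "(\<lambda>n. t *\<^sub>R 1 - X n) \<longlonglongrightarrow> t *\<^sub>R 1 - a" by (intro tendsto_intros lim)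
    show "\<exists>N. \<forall>n\<ge>N. norm (t *\<^sub>R 1 - X n) \<le> t" using X t pos_iff_near_scalar by blast
  qed
  ultimately show "a \<in> {a. 0 \<preceq> a}" using pos_iff_near_scalar by blast
qed

lemma pos_mult:
  fixes a b :: 'a
  assumes "0 \<preceq> a" "0 \<preceq> b"
  shows "0 \<preceq> a * b"
proof -
  obtain x y where "a = star x * x" "b = star y * y" using assms by (auto simp: cstar_le_def)
  then have "a * b = star (x * y) * (x * y)" by (simp add: star_mult comm_simps)
  then show ?thesis by (auto simp: cstar_le_def)
qed

lemma pos_antisym:
  fixes a :: 'a
  assumes "0 \<preceq> a" "0 \<preceq> - a"
  shows "a = 0"
proof -
  obtain b d where "star b = b" "b * b = a" "star d = d" "d * d = - a"
    using assms pos_sqrt_exists by metis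
  then show ?thesis using norm_le_sum_squares[of b d] by simp
qed

lemma le_scalar_if_norm_le:
  fixes a :: 'a
  assumes "star a = a" "norm a \<le> t"
  shows "a \<preceq> t *\<^sub>R 1"
proof -
  have "star (t *\<^sub>R 1 - a) = t *\<^sub>R 1 - a" by (simp add: star_diff star_scaleR assms)
  moreover have "norm (t *\<^sub>R 1 - (t *\<^sub>R 1 - a)) \<le> t" using assms by simp
  ultimately obtain s where "star s = s" "s * s = t *\<^sub>R 1 - a" using sqrt_near_scalar by metis
  then show ?thesis using square_pos[of s] cstar_le_iff_diff by metis
qed

text \<open>The product \<open>(t - a) (t + a) = t\<^sup>2 - a\<^sup>2\<close> is positive, hence a square, and \<open>norm_le_sum_squares\<close>
applies.\<close>

lemma norm_le_if_between_scalars: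
  fixes a :: 'a
  assumes a: "star a = a" "0 \<preceq> t *\<^sub>R 1 - a" "0 \<preceq> t *\<^sub>R 1 + a" and t: "0 \<le> t"
  shows "norm a \<le> t"
proof -
  have "0 \<preceq> (t *\<^sub>R 1 - a) * (t *\<^sub>R 1 + a)" by (rule pos_mult[OF a(2,3)])
  then obtain d where d: "star d = d" "d * d = (t *\<^sub>R 1 - a) * (t *\<^sub>R 1 + a)"
    using pos_sqrt_exists by blast
  have "a * a + d * d = (t * t) *\<^sub>R 1" unfolding d(2) by (simp add: algebra_simps)
  then have "(norm a)\<^sup>2 \<le> t\<^sup>2"
    using norm_le_sum_squares[OF a(1) d(1)] t by (simp add: power2_eq_square)
  then show ?thesis using t power2_le_imp_le by blast
qed

section \<open>Absolute value and suprema of pairs\<close>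

lemma abs_exists:
  fixes a :: 'a
  assumes a: "star a = a"
  shows "\<exists>m. 0 \<preceq> m \<and> m * m = a * a"
proof -
  obtain s where s: "star s = s" "s * s = a * a"
     "norm (sqrt ((norm a)\<^sup>2) *\<^sub>R 1 - s) \<le> sqrt ((norm a)\<^sup>2)"
    using sqrt_near_scalar[of "a * a" "(norm a)\<^sup>2"] norm_scalar_diff_square[OF a order_refl] a
    by (auto simp: star_mult)
  have "norm (norm a *\<^sub>R 1 - s) \<le> norm a" using s by simp
  then obtain u where "star u = u" "u * u = s" using sqrt_near_scalar[OF s(1)] by blast
  then show ?thesis using s square_pos[of u] by auto
qed

text \<open>Pointwise this says that \<open>w s \<ge> 0\<close> and \<open>w + s \<ge> 0\<close> force \<open>w \<ge> 0\<close>, with \<open>w = m - a\<close> and \<open>s = m + a\<close>.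
Without points, let \<open>k\<close> be the absolute value of \<open>w\<close>, so that \<open>n = k - w\<close> is twice the negative part.
Multiplying the two hypotheses by \<open>n\<^sup>2\<close> and \<open>n\<^sup>2 k\<close>, where \<open>n w = - n k\<close>, leaves \<open>- (n k)\<^sup>2 \<ge> 0\<close>.\<close>

lemma le_if_square_le:
  fixes a m :: 'a
  assumes m: "0 \<preceq> m" and a: "star a = a" and sq: "a * a \<preceq> m * m"
  shows "a \<preceq> m"
proof -
  define w s where "w = m - a" and "s = m + a"
  have w: "star w = w" by (simp add: w_def star_diff a star_pos[OF m])
  obtain k where k: "0 \<preceq> k" "k * k = w * w" using abs_exists[OF w] by blast
  define n where "n = k - w"
  have n: "star n = n" by (simp add: n_def star_diff w star_pos[OF k(1)])
  have nw: "n * w = - (n * k)" using k(2) by (simp add: n_def comm_simps)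
  have ws: "0 \<preceq> w * s" using sq by (simp add: w_def s_def cstar_le_iff_diff[of "a * a"] comm_simps)
  have 1: "0 \<preceq> - (n * n * (k * s))"
  proof -
    have "n * n * (w * s) = n * (n * w) * s" by (simp add: comm_simps)
    also have "\<dots> = - (n * n * (k * s))" unfolding nw by (simp add: comm_simps)
    finally show ?thesis using pos_mult[OF square_pos[OF n] ws] by simp
  qed
  have 2: "0 \<preceq> n * n * (k * s) - (n * k) * (n * k)"
  proof -
    have "0 \<preceq> w + s" using scaleR_pos[of 2, OF _ m] by (simp add: w_def s_def scaleR_2)
    then have "0 \<preceq> n * n * (k * (w + s))" by (intro pos_mult[OF square_pos[OF n] pos_mult[OF k(1)]])
    moreover have "n * n * (k * (w + s)) = n * n * (k * s) + n * (n * w) * k"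
      by (simp add: comm_simps)
    moreover have "n * (n * w) * k = - ((n * k) * (n * k))" unfolding nw by (simp add: comm_simps)
    ultimately show ?thesis by simp
  qed
  have "0 \<preceq> - ((n * k) * (n * k))" using pos_add[OF 1 2] by simp
  moreover have nk: "star (n * k) = n * k" by (simp add: star_mult n star_pos[OF k(1)] comm)
  ultimately have "(n * k) * (n * k) = 0" using pos_antisym[OF square_pos[OF nk]] by simp
  then have "n * k = 0" using norm_square[OF nk] by simp
  then have "n * n = 0"
    using nw right_diff_distrib[of n k w] by (simp flip: n_def)
  then have "n = 0" using norm_square[OF n] by simp
  then have "w = k" by (simp add: n_def)
  then show ?thesis using k(1) cstar_le_iff_diff[of a m] by (simp add: w_def)
qed

text \<open>If \<open>u\<close> lies above both \<open>a\<close> and \<open>- a\<close>, then \<open>u\<^sup>2 - a\<^sup>2 = (u - a) (u + a) \<ge> 0\<close>.\<close>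

lemma abs_least_upper_bound:
  fixes a m :: 'a
  assumes m: "0 \<preceq> m" "m * m = a * a" and a: "star a = a"
  shows "a \<preceq> m" "- a \<preceq> m" "\<And>u. a \<preceq> u \<Longrightarrow> - a \<preceq> u \<Longrightarrow> m \<preceq> u"
proof -
  show "a \<preceq> m" "- a \<preceq> m" by (rule le_if_square_le; simp add: m a cstar_le_refl)+
  fix u assume u: "a \<preceq> u" "- a \<preceq> u"
  then have 1: "0 \<preceq> u - a" "0 \<preceq> u + a" using cstar_le_iff_diff[of a u] cstar_le_iff_diff[of "- a" u] by auto
  have "0 \<preceq> (1/2) *\<^sub>R ((u - a) + (u + a))" by (intro scaleR_pos pos_add 1) simp
  then have "0 \<preceq> u" by (simp flip: scaleR_2)
  moreover have "m * m \<preceq> u * u"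
    using pos_mult[OF 1] by (simp add: m(2) cstar_le_iff_diff[of "a * a"] comm_simps)
  ultimately show "m \<preceq> u" using le_if_square_le star_pos[OF m(1)] by blast
qed

end

section \<open>The numerical radius\<close>

lemma scaleC_power:
  "(c *\<^sub>C x) ^ n = c ^ n *\<^sub>C x ^ n" for x :: "'a::{cstar_algebra,real_normed_algebra_1}"
  by (induction n) (simp_all add: scaleC_one scaleC_mult_left scaleC_mult_right scaleC_scaleC)

text \<open>The coefficient identity behind \<open>exp (x + y) = exp x * exp y\<close>, cleared of factorials.\<close>

lemma binomial_commuting:
  fixes x y :: "'a::{real_normed_algebra_1,banach}"
  assumes "x * y = y * x"
  shows "(x + y) ^ m = (\<Sum>i\<le>m. real (m choose i) *\<^sub>R (x ^ i * y ^ (m - i)))"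
proof -
  have "(x + y) ^ m = fact m *\<^sub>R ((x + y) ^ m /\<^sub>R fact m)" by simp
  also have "\<dots> = fact m *\<^sub>R (\<Sum>i\<le>m. (x ^ i /\<^sub>R fact i) * (y ^ (m - i) /\<^sub>R fact (m - i)))"
    by (subst exp_series_add_commuting[OF assms]) (rule refl)
  also have "\<dots> = (\<Sum>i\<le>m. real (m choose i) *\<^sub>R (x ^ i * y ^ (m - i)))"
    unfolding scaleR_sum_right by (rule sum.cong) (simp_all add: binomial_fact field_simps)
  finally show ?thesis .
qed

text \<open>Here \<open>n + 1 + i\<close> lies between \<open>n + 1\<close> and \<open>3 n + 1\<close>, so \<open>2 n + 1\<close> is the only multiple of \<open>2 n + 1\<close> that it
can equal.\<close>

lemma sum_powers_root_of_unity:
  fixes n i :: nat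
  defines "\<omega> \<equiv> exp (2 * of_real pi * \<i> / of_nat (2 * n + 1))"
  assumes "i \<le> 2 * n"
  shows "(\<Sum>j<2 * n + 1. \<omega> ^ (j * (n + 1)) * (\<omega> ^ j) ^ i) = (if i = n then of_nat (2 * n + 1) else 0)"
proof -
  let ?N = "2 * n + 1"
  define \<rho> where "\<rho> = \<omega> ^ (n + 1 + i)"
  have pow: "\<omega> ^ k = exp (2 * of_real pi * \<i> * of_nat k / of_nat ?N)" for k
    unfolding \<omega>_def by (subst exp_of_nat_mult[symmetric]) (simp add: field_simps)
  have one_iff: "\<omega> ^ k = 1 \<longleftrightarrow> ?N dvd k" for k
    unfolding pow by (rule complex_root_unity_eq_1) simp
  have sum: "(\<Sum>j<?N. \<omega> ^ (j * (n + 1)) * (\<omega> ^ j) ^ i) = (\<Sum>j<?N. \<rho> ^ j)"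
    by (rule sum.cong) (simp_all add: \<rho>_def algebra_simps flip: power_mult power_add)
  show ?thesis
  proof (cases "i = n")
    case True
    then have "\<rho> = 1" unfolding \<rho>_def one_iff by (simp add: mult_2)
    then show ?thesis using True sum by simp
  next
    case False
    have "\<not> ?N dvd n + 1 + i"
    proof
      assume "?N dvd n + 1 + i"
      then obtain q where q: "n + 1 + i = ?N * q" by (elim dvdE)
      have "q \<noteq> 0" using q by (intro notI) simp
      moreover have "q \<noteq> 1" using q False by (intro notI) simp
      ultimately have "2 \<le> q" by simp
      then have "?N * 2 \<le> ?N * q" by (intro mult_le_mono) simp_all
      with q assms(2) show False by simp
    qed
    then have "\<rho> \<noteq> 1" unfolding \<rho>_def one_iff .
    moreover have "\<rho> ^ ?N = 1" unfolding \<rho>_def power_mult[symmetric] one_iff by (rule dvd_triv_right)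
    ultimately have "(\<Sum>j<?N. \<rho> ^ j) = 0" by (simp only: sum_gp_strict if_False diff_self div_0)
    then show ?thesis using False sum by simp
  qed
qed

context
  assumes comm: "\<And>x y :: 'a::{cstar_algebra,real_normed_algebra_1}. x * y = y * x"
begin

text \<open>The factor in front of each power selects the middle term of its binomial expansion: the sum over the
rotations cancels all others.\<close>

lemma average_rotated_powers:
  fixes a :: 'a and n :: nat
  defines "\<omega> \<equiv> exp (2 * of_real pi * \<i> / of_nat (2 * n + 1))"
  shows "(\<Sum>j<2 * n + 1. \<omega> ^ (j * (n + 1)) *\<^sub>C (\<omega> ^ j *\<^sub>C a + star a) ^ (2 * n))
    = (real (2 * n + 1) * real ((2 * n) choose n)) *\<^sub>R (star a * a) ^ n"
    (is "?L = _")
proof -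
  let ?N = "2 * n + 1"
  let ?t = "\<lambda>i. real ((2 * n) choose i) *\<^sub>R (a ^ i * star a ^ (2 * n - i))"
  have "(\<omega> ^ j *\<^sub>C a + star a) ^ (2 * n) = (\<Sum>i\<le>2*n. (\<omega> ^ j) ^ i *\<^sub>C ?t i)" for j
    by (subst binomial_commuting)
       (simp_all add: comm scaleC_power scaleC_mult_left scaleC_scaleR)
  then have "?L = (\<Sum>j<?N. \<Sum>i\<le>2*n. (\<omega> ^ (j * (n + 1)) * (\<omega> ^ j) ^ i) *\<^sub>C ?t i)"
    by (simp only: complex_vector.scale_sum_right scaleC_scaleC)
  also have "\<dots> = (\<Sum>i\<le>2*n. (\<Sum>j<?N. \<omega> ^ (j * (n + 1)) * (\<omega> ^ j) ^ i) *\<^sub>C ?t i)"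
    unfolding complex_vector.scale_sum_left by (rule sum.swap)
  also have "\<dots> = (\<Sum>i\<le>2*n. if i = n then of_nat ?N *\<^sub>C ?t i else 0)"
    unfolding \<omega>_def by (intro sum.cong refl, subst sum_powers_root_of_unity) auto
  also have "\<dots> = of_nat ?N *\<^sub>C ?t n" by simp
  also have "of_nat ?N = complex_of_real (real ?N)" by simp
  also have "a ^ n * star a ^ (2 * n - n) = (star a * a) ^ n"
  proof -
    have "(x * y) ^ m = x ^ m * y ^ m" for x y :: 'a and m
      by (induction m) (simp_all add: mult.assoc left_comm[OF comm])
    then show ?thesis by (simp add: comm)
  qed
  finally show ?thesis by (simp only: scaleC_of_real scaleR_scaleR)
qed

lemma norm_power_self_adjoint:
  fixes b :: 'a
  assumes "star b = b"
  shows "norm (b ^ (2 ^ k)) = norm b ^ (2 ^ k)"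
proof (induction k)
  case (Suc k)
  have star_power: "star (b ^ m) = b ^ m" for m
    by (induction m) (simp_all add: star_mult assms comm)
  have "b ^ (2 ^ Suc k) = b ^ (2 ^ k) * b ^ (2 ^ k)" by (simp add: mult_2 flip: power_add)
  then have "norm (b ^ (2 ^ Suc k)) = (norm (b ^ (2 ^ k)))\<^sup>2"
    using norm_square[OF star_power] by simp
  then show ?case using Suc by (simp add: mult.commute flip: power_mult)
qed simp

text \<open>Bounding the average of \<open>average_rotated_powers\<close> term by term and using that the central binomial
coefficient is at least \<open>4^n / (2 n)\<close> gives \<open>norm a ^ (2 n) \<le> 2 n M ^ (2 n)\<close>. The factor \<open>2 n\<close>
disappears under roots of order \<open>2 n\<close>. Powers of two suffice for \<open>n\<close>, and for these the C*-identity
evaluates \<open>norm ((star a * a) ^ n)\<close>.\<close>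

lemma norm_le_if_rotations_unital:
  fixes a :: 'a
  assumes M: "0 \<le> M" and rot: "\<And>\<eta>. cmod \<eta> = 1 \<Longrightarrow> norm (\<eta> *\<^sub>C a + star a) \<le> 2 * M"
  shows "norm a \<le> M"
proof -
  have bound: "(norm a)\<^sup>2 ^ n \<le> 2 * real n * (M\<^sup>2) ^ n" if n: "n = 2 ^ k" for n k
  proof -
    define \<omega> where "\<omega> = exp (2 * of_real pi * \<i> / of_nat (2 * n + 1))"
    have \<omega>: "cmod (\<omega> ^ j) = 1" for j by (simp add: \<omega>_def norm_power)
    let ?S = "\<Sum>j<2 * n + 1. \<omega> ^ (j * (n + 1)) *\<^sub>C (\<omega> ^ j *\<^sub>C a + star a) ^ (2 * n)"
    let ?B = "real ((2 * n) choose n)"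
    have "norm ?S \<le> (\<Sum>j<2 * n + 1. (2 * M) ^ (2 * n))"
    proof (rule sum_norm_le)
      fix j
      have "norm ((\<omega> ^ j *\<^sub>C a + star a) ^ (2 * n)) \<le> norm (\<omega> ^ j *\<^sub>C a + star a) ^ (2 * n)"
        by (rule norm_power_ineq)
      also have "\<dots> \<le> (2 * M) ^ (2 * n)" by (intro power_mono rot \<omega>) simp
      finally show "norm (\<omega> ^ (j * (n + 1)) *\<^sub>C (\<omega> ^ j *\<^sub>C a + star a) ^ (2 * n)) \<le> (2 * M) ^ (2 * n)"
        by (simp only: norm_scaleC \<omega> mult_1)
    qed
    moreover have "norm ?S = real (2 * n + 1) * ?B * (norm a)\<^sup>2 ^ n"
    proof -
      have "norm ((star a * a) ^ n) = (norm a)\<^sup>2 ^ n"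
        using norm_power_self_adjoint[of "star a * a" k]
        by (simp add: star_mult star_star cstar_identity n)
      then show ?thesis unfolding \<omega>_def average_rotated_powers by (simp add: abs_mult)
    qed
    ultimately have "real (2 * n + 1) * (?B * (norm a)\<^sup>2 ^ n) \<le> real (2 * n + 1) * (2 * M) ^ (2 * n)"
      by (simp add: mult.assoc)
    then have "?B * (norm a)\<^sup>2 ^ n \<le> (2 * M) ^ (2 * n)"
      by (rule mult_left_le_imp_le) simp
    moreover have "4 ^ n / (2 * real n) * (norm a)\<^sup>2 ^ n \<le> ?B * (norm a)\<^sup>2 ^ n"
      by (intro mult_right_mono central_binomial_lower_bound) (simp_all add: n)
    moreover have "(2 * M) ^ (2 * n) = 4 ^ n * (M\<^sup>2) ^ n"
      by (simp add: power_mult power_mult_distrib)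
    ultimately have "4 ^ n * ((norm a)\<^sup>2 ^ n / (2 * real n)) \<le> 4 ^ n * (M\<^sup>2) ^ n" by simp
    then have "(norm a)\<^sup>2 ^ n / (2 * real n) \<le> (M\<^sup>2) ^ n" by (rule mult_left_le_imp_le) simp
    then show ?thesis by (simp add: n field_simps)
  qed
  show ?thesis
  proof (rule ccontr)
    assume "\<not> norm a \<le> M"
    then have less: "M < norm a" by simp
    show False
    proof (cases "M = 0")
      case True then show False using bound[of 1 0] less by simp
    next
      case False
      then have M2: "0 < M\<^sup>2" using M by simp
      define q where "q = (norm a)\<^sup>2 / M\<^sup>2"
      have "1 < q" using less M M2 by (simp add: q_def power_strict_mono)
      then have "(\<lambda>n. of_nat n / q ^ n) \<longlonglongrightarrow> 0" by (intro lim_n_over_pown) simp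
      then have "(\<lambda>k. real (2 ^ k) / q ^ (2 ^ k)) \<longlonglongrightarrow> 0"
        using LIMSEQ_subseq_LIMSEQ[of "\<lambda>n. real n / q ^ n" 0 "\<lambda>k. 2 ^ k"]
        by (simp add: o_def strict_mono_def)
      then have "eventually (\<lambda>k. real (2 ^ k) / q ^ (2 ^ k) < 1 / 2) sequentially"
        by (rule order_tendstoD) simp
      then obtain k where k: "real (2 ^ k) / q ^ (2 ^ k) < 1 / 2"
        by (auto simp: eventually_sequentially)
      have "q ^ (2 ^ k) \<le> 2 * real (2 ^ k)"
        using bound[OF refl, of k] M2 by (simp add: q_def power_divide field_simps)
      then show False using k \<open>1 < q\<close> by (simp add: field_simps)
    qed
  qed
qed

end

section \<open>Order in commutative algebras without unit\<close>

text \<open>Positive elements of the unitization with scalar part \<open>0\<close> have roots in the algebra itself, since the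
scalar part of \<open>star x * x\<close> is \<open>cnj (scal x) * scal x\<close>.\<close>

lemma embed_pos_iff: "0 \<preceq> embed a \<longleftrightarrow> 0 \<preceq> a"
proof
  assume "0 \<preceq> embed a"
  then obtain x where x: "embed a = star x * x" by (auto simp: cstar_le_def)
  from arg_cong[OF this, of scal] have "scal x = 0"
    by (simp add: star_unitization_def unitization_ops)
  then have "a = star (alg x) * alg x"
    using arg_cong[OF x, of alg] by (simp add: star_unitization_def unitization_ops)
  then show "0 \<preceq> a" by (auto simp: cstar_le_def)
next
  assume "0 \<preceq> a"
  then obtain x where "a = star x * x" by (auto simp: cstar_le_def)
  then have "embed a = star (embed x) * embed x" by (simp add: embed_ops)
  then show "0 \<preceq> embed a" by (auto simp: cstar_le_def)
qed

lemma embed_le_iff: "embed a \<preceq> embed b \<longleftrightarrow> a \<preceq> b"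
  using embed_pos_iff[of "b - a"] cstar_le_iff_diff[of a b] cstar_le_iff_diff[of "embed a" "embed b"]
  by (simp add: embed_ops)

lemma embed_alg: "scal x = 0 \<Longrightarrow> embed (alg x) = x"
  by (cases x) simp

lemma star_embed_iff: "star (embed a) = embed a \<longleftrightarrow> star a = a"
  by (simp add: star_unitization_def)

lemma bounded_linear_embed: "bounded_linear embed"
  by (rule bounded_linear_intro[where K = 1]) (simp_all add: embed_ops)

context
  assumes comm: "\<And>x y :: 'a::cstar_algebra. x * y = y * x"
begin

lemma commU: "x * y = y * (x :: 'a unitization)"
  using comm unitization_commute by blast

lemma cone_add: "0 \<preceq> a \<Longrightarrow> 0 \<preceq> b \<Longrightarrow> 0 \<preceq> a + b" for a b :: 'a
  using pos_add[OF commU, of "embed a" "embed b"] by (simp add: embed_pos_iff flip: embed_ops(1))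

lemma cstar_le_trans: "a \<preceq> b \<Longrightarrow> b \<preceq> c \<Longrightarrow> a \<preceq> c" for a b c :: 'a
  using cone_add[of "b - a" "c - b"] by (simp add: cstar_le_iff_diff[of a] cstar_le_iff_diff[of b])

lemma closed_cone: "closed {a::'a. 0 \<preceq> a}"
proof -
  have "closed (embed -` {x :: 'a unitization. 0 \<preceq> x})"
    by (intro closed_vimage closed_pos[OF commU] linear_continuous_on bounded_linear_embed)
  then show ?thesis by (simp add: vimage_def embed_pos_iff)
qed

text \<open>The join is \<open>(a + b + \<bar>a - b\<bar>) / 2\<close>; the absolute value has scalar part \<open>0\<close> because its square has. Leastness
is stated among all elements of the unitization, so that scalar upper bounds of \<open>a\<close> and \<open>b\<close> are upper
bounds of the join as well.\<close>

lemma join_exists: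
  fixes a b :: 'a
  assumes "star a = a" "star b = b"
  shows "\<exists>j. star j = j \<and> a \<preceq> j \<and> b \<preceq> j \<and> (\<forall>u. embed a \<preceq> u \<longrightarrow> embed b \<preceq> u \<longrightarrow> embed j \<preceq> u)"
proof -
  define c where "c = embed (a - b)"
  have c: "star c = c" by (simp add: c_def star_embed_iff star_diff assms)
  then obtain m where m: "0 \<preceq> m" "m * m = c * c" using abs_exists[OF commU] by blast
  have "scal m = 0" using arg_cong[OF m(2), of scal] by (simp add: c_def unitization_ops)
  then obtain m' where m': "m = embed m'" using embed_alg by metis
  note lub = abs_least_upper_bound[OF commU m c]
  have lub': "a - b \<preceq> m'" "- (a - b) \<preceq> m'"
    using lub(1,2) by (simp_all add: c_def m' embed_le_iff flip: embed_ops(4))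
  define j where "j = (1/2) *\<^sub>R (a + b + m')"
  have "star m' = m'" using star_pos[OF m(1)] by (simp add: m' star_embed_iff)
  then have "star j = j" by (simp add: j_def star_scaleR star_add assms)
  have half: "x \<preceq> y \<Longrightarrow> 0 \<preceq> (1/2) *\<^sub>R (y - x)" for x y :: 'a
    by (intro scaleR_pos) (simp_all add: cstar_le_iff_diff[of x])
  have "j - a = (1/2) *\<^sub>R (m' - (a - b))" "j - b = (1/2) *\<^sub>R (m' - - (a - b))"
    using scaleR_half_double[of a] scaleR_half_double[of b]
    by (simp_all add: j_def algebra_simps)
  then have "a \<preceq> j" "b \<preceq> j"
    using half[OF lub'(1)] half[OF lub'(2)] by (simp_all only: cstar_le_iff_diff[of _ j])
  moreover have "embed j \<preceq> u" if "embed a \<preceq> u" "embed b \<preceq> u" for u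
  proof -
    have 2: "0 \<preceq> 2 *\<^sub>R (u - embed a)" "0 \<preceq> 2 *\<^sub>R (u - embed b)"
      using that by (auto intro!: scaleR_pos simp: cstar_le_iff_diff[of _ u])
    have "m \<preceq> 2 *\<^sub>R u - embed (a + b)"
      by (rule lub(3); subst cstar_le_iff_diff;
          use 2 in \<open>simp add: c_def embed_ops scaleR_2 algebra_simps\<close>)
    then have "0 \<preceq> (1/2) *\<^sub>R (2 *\<^sub>R u - embed (a + b) - m)"
      by (intro scaleR_pos) (simp_all add: cstar_le_iff_diff[of m])
    moreover have "u - embed j = (1/2) *\<^sub>R (2 *\<^sub>R u - embed (a + b) - m)"
      by (simp add: j_def m' embed_ops algebra_simps)
    ultimately show ?thesis by (simp only: cstar_le_iff_diff[of "embed j"])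
  qed
  ultimately show ?thesis using \<open>star j = j\<close> by blast
qed

lemma embed_le_scalar_if_norm_le:
  "star a = a \<Longrightarrow> norm a \<le> t \<Longrightarrow> embed a \<preceq> t *\<^sub>R 1" for a :: 'a
  by (rule le_scalar_if_norm_le[OF commU]) (simp_all add: star_embed_iff)

lemma norm_le_if_embed_le_scalar:
  fixes a :: 'a
  assumes "star a = a" "embed a \<preceq> t *\<^sub>R 1" "embed (- a) \<preceq> t *\<^sub>R 1" "0 \<le> t"
  shows "norm a \<le> t"
  using norm_le_if_between_scalars[OF commU, of "embed a" t] assms
  by (simp add: star_embed_iff cstar_le_iff_diff[of "embed _"] embed_ops cstar_le_iff_diff[of "- embed _"])

text \<open>The truncation is \<open>min e 1 = (e + 1 - \<bar>e - 1\<bar>) / 2\<close>. It lies in the algebra although \<open>1\<close> does not: the scalar part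
of \<open>\<bar>e - 1\<bar>\<close> is nonnegative with square \<open>1\<close>, so that of the truncation is \<open>(0 + 1 - 1) / 2\<close>.\<close>

lemma truncation_exists:
  fixes e :: 'a
  assumes e: "star e = e"
  shows "\<exists>e'. star e' = e' \<and> embed e' \<preceq> 1 \<and> (\<forall>b. b \<preceq> e \<longrightarrow> embed b \<preceq> 1 \<longrightarrow> b \<preceq> e')"
proof -
  define w where "w = embed e - 1"
  have w: "star w = w" using e by (simp add: w_def star_diff star_embed_iff[THEN iffD2])
  then obtain m where m: "0 \<preceq> m" "m * m = w * w" using abs_exists[OF commU] by blast
  note lub = abs_least_upper_bound[OF commU m w]
  obtain x where x: "m = star x * x" using m(1) by (auto simp: cstar_le_def)
  have scal_m: "scal m = complex_of_real ((cmod (scal x))\<^sup>2)"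
    by (simp add: x star_unitization_def unitization_ops complex_norm_square mult.commute
        del: of_real_power)
  moreover have "scal m * scal m = 1"
    using arg_cong[OF m(2), of scal] by (simp add: w_def unitization_ops)
  ultimately have "((cmod (scal x))\<^sup>2) * ((cmod (scal x))\<^sup>2) = 1"
    by (metis of_real_eq_1_iff of_real_mult)
  then have "(cmod (scal x))\<^sup>2 = 1 \<or> (cmod (scal x))\<^sup>2 = - 1"
    by (rule square_eq_1_iff[THEN iffD1])
  then have "(cmod (scal x))\<^sup>2 = 1"
    using zero_le_power2[of "cmod (scal x)"] by linarith
  then have "scal m = 1" using scal_m by simp
  define f where "f = (1/2) *\<^sub>R (embed e + 1 - m)"
  have "scal f = 0" by (simp add: f_def unitization_ops \<open>scal m = 1\<close>)
  then obtain e' where e': "f = embed e'" using embed_alg by metis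
  have half: "x \<preceq> y \<Longrightarrow> 0 \<preceq> (1/2) *\<^sub>R (y - x)" for x y :: "'a unitization"
    by (intro scaleR_pos) (simp_all add: cstar_le_iff_diff[of x])
  have "star f = f"
    using w star_pos[OF m(1)] by (simp add: f_def w_def star_scaleR star_diff star_add)
  then have "star e' = e'" by (simp add: e' star_embed_iff)
  moreover have "embed e' \<preceq> 1"
  proof -
    have "1 - f = (1/2) *\<^sub>R (m - w)"
      using scaleR_left_distrib[of "1/2" "1/2" "1 :: 'a unitization"]
      by (simp add: f_def w_def algebra_simps)
    then show ?thesis using half[OF lub(1)] by (simp only: cstar_le_iff_diff[of f] flip: e')
  qed
  moreover have "b \<preceq> e'" if b: "b \<preceq> e" "embed b \<preceq> 1" for b
  proof -
    have 2: "0 \<preceq> 2 *\<^sub>R (embed e - embed b)" "0 \<preceq> 2 *\<^sub>R (1 - embed b)"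
      using b embed_le_iff[of b e]
      by (auto intro!: scaleR_pos simp: cstar_le_iff_diff[of "embed b"])
    have "m \<preceq> embed e + 1 - 2 *\<^sub>R embed b"
      by (rule lub(3); subst cstar_le_iff_diff;
          use 2 in \<open>simp add: w_def scaleR_2 algebra_simps\<close>)
    moreover have "f - embed b = (1/2) *\<^sub>R (embed e + 1 - 2 *\<^sub>R embed b - m)"
      by (simp add: f_def algebra_simps)
    ultimately have "embed b \<preceq> f" using half by (simp only: cstar_le_iff_diff[of "embed b"])
    then show ?thesis by (simp add: e' embed_le_iff)
  qed
  ultimately show ?thesis by blast
qed

text \<open>With \<open>\<eta> = \<zeta>\<^sup>2\<close>, the real part of \<open>\<zeta> a\<close> is a rotation of \<open>(\<eta> a + star a) / 2\<close>.\<close>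

lemma norm_le_if_re_parts:
  fixes a :: 'a
  assumes M: "0 \<le> M" and re: "\<And>\<zeta>. cmod \<zeta> = 1 \<Longrightarrow> norm (re_part (\<zeta> *\<^sub>C a)) \<le> M"
  shows "norm a \<le> M"
proof -
  have "norm (embed a) \<le> M"
  proof (rule norm_le_if_rotations_unital[OF commU M])
    fix \<eta> :: complex assume \<eta>: "cmod \<eta> = 1"
    define \<zeta> where "\<zeta> = csqrt \<eta>"
    have \<zeta>: "\<zeta> * \<zeta> = \<eta>" using power2_csqrt[of \<eta>] by (simp add: \<zeta>_def power2_eq_square)
    have cm: "cmod \<zeta> = 1" using \<eta> by (simp add: \<zeta>_def)
    then have cnj: "\<zeta> * cnj \<zeta> = 1" by (metis complex_norm_square of_real_1 one_power2)
    have "\<eta> *\<^sub>C a + star a = (2 * \<zeta>) *\<^sub>C re_part (\<zeta> *\<^sub>C a)"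
    proof -
      have "(2 * \<zeta>) *\<^sub>C re_part (\<zeta> *\<^sub>C a) = \<zeta> *\<^sub>C (2 *\<^sub>R re_part (\<zeta> *\<^sub>C a))"
        by (simp add: scaleC_scaleC mult.commute flip: scaleC_of_real)
      then show ?thesis
        by (simp add: re_part_def star_scaleC scaleC_add_right scaleC_scaleC \<zeta> cnj scaleC_one)
    qed
    then have "norm (\<eta> *\<^sub>C a + star a) \<le> 2 * M"
      using re[OF cm] by (simp add: norm_scaleC norm_mult cm)
    then show "norm (\<eta> *\<^sub>C embed a + star (embed a)) \<le> 2 * M"
      by (simp flip: embed_ops)
  qed
  then show ?thesis by simp
qed

section \<open>Countable suprema\<close>

text \<open>The joins of initial segments form an increasing sequence. An upper bound alone makes it norm-bounded,
as it starts at \<open>b 0\<close>.\<close>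

lemma countable_sup_exists:
  fixes b :: "nat \<Rightarrow> 'a"
  assumes msc: "monotone_sequentially_complete TYPE('a)"
    and star: "\<And>k. star (b k) = b k" and bdd: "\<And>k. embed (b k) \<preceq> C *\<^sub>R 1"
  shows "\<exists>s. star s = s \<and> (\<forall>k. b k \<preceq> s) \<and> (\<forall>u. star u = u \<longrightarrow> (\<forall>k. b k \<preceq> u) \<longrightarrow> s \<preceq> u)"
proof -
  obtain join where join: "\<And>x y :: 'a. star x = x \<Longrightarrow> star y = y \<Longrightarrow> star (join x y) = join x y
      \<and> x \<preceq> join x y \<and> y \<preceq> join x y \<and> (\<forall>u. embed x \<preceq> u \<longrightarrow> embed y \<preceq> u \<longrightarrow> embed (join x y) \<preceq> u)"
    using join_exists by metis
  define J where "J = rec_nat (b 0) (\<lambda>k x. join x (b (Suc k)))"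
  have J: "J 0 = b 0" "\<And>k. J (Suc k) = join (J k) (b (Suc k))" by (simp_all add: J_def)
  have starJ: "star (J k) = J k" for k by (induction k) (simp_all add: J star join)
  have b_le: "b k \<preceq> J k" for k by (cases k) (simp_all add: J join star starJ cstar_le_refl)
  have J_step: "J k \<preceq> J (Suc k)" for k by (simp add: J(2) join star starJ)
  have J_mono: "J k \<preceq> J (k + i)" for k i
    by (induction i) (use J_step cstar_le_trans in \<open>auto simp: cstar_le_refl\<close>)
  have J_least: "embed (J k) \<preceq> u" if "\<And>k. embed (b k) \<preceq> u" for u k
    by (induction k) (use that join star starJ in \<open>auto simp: J\<close>)
  define C' where "C' = max C (norm (b 0))"
  have J_bdd: "norm (J k) \<le> C'" for k
  proof (rule norm_le_if_embed_le_scalar[OF starJ])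
    have "(C *\<^sub>R 1 :: 'a unitization) \<preceq> C' *\<^sub>R 1"
      by (subst cstar_le_iff_diff, subst scaleR_left_diff_distrib[symmetric], rule scaleR_pos)
         (use square_pos[of "1 :: 'a unitization"] in \<open>simp_all add: C'_def\<close>)
    then show "embed (J k) \<preceq> C' *\<^sub>R 1"
      by (intro J_least) (rule unital_le_trans[OF commU bdd])
    have "embed (- J k) \<preceq> embed (- b 0)"
      using J_mono[of 0 k] by (simp add: embed_le_iff J cstar_le_iff_diff[of "b 0"] cstar_le_iff_diff[of "- J k"])
    moreover have "embed (- b 0) \<preceq> C' *\<^sub>R 1"
      by (rule embed_le_scalar_if_norm_le) (simp_all add: star C'_def)
    ultimately show "embed (- J k) \<preceq> C' *\<^sub>R 1" by (rule unital_le_trans[OF commU])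
  qed (simp add: C'_def le_max_iff_disj)
  have "range J \<subseteq> self_adjoint" by (auto simp: self_adjoint_def starJ)
  moreover have "bounded (range J)" using J_bdd by (auto simp: bounded_iff)
  moreover have "monotone (\<le>) cstar_le J"
    by (rule monotoneI) (metis J_mono le_Suc_ex)
  ultimately have "\<exists>s\<in>self_adjoint. (\<forall>k. J k \<preceq> s) \<and>
      (\<forall>u\<in>self_adjoint. (\<forall>k. J k \<preceq> u) \<longrightarrow> s \<preceq> u)"
    using msc[unfolded monotone_sequentially_complete_def, rule_format, of J] by simp
  then obtain s where s: "s \<in> self_adjoint" "\<And>k. J k \<preceq> s"
      "\<And>u. u \<in> self_adjoint \<Longrightarrow> (\<forall>k. J k \<preceq> u) \<Longrightarrow> s \<preceq> u" by blast
  show ?thesis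
  proof (intro exI[of _ s] conjI allI impI)
    show "star s = s" using s(1) by (simp add: self_adjoint_def)
    show "b k \<preceq> s" for k using b_le s(2) cstar_le_trans by blast
    show "s \<preceq> u" if "star u = u" "\<forall>k. b k \<preceq> u" for u
      using s(3)[of u] that J_least[of "embed u"] by (auto simp: self_adjoint_def embed_le_iff)
  qed
qed

text \<open>Prepending \<open>0\<close> to the sequence makes the bound positive; truncating the supremum at \<open>1\<close> keeps its norm at most \<open>1\<close>.\<close>

lemma countable_local_unit_exists:
  fixes b :: "nat \<Rightarrow> 'a"
  assumes msc: "monotone_sequentially_complete TYPE('a)"
    and star: "\<And>k. star (b k) = b k" and norm: "\<And>k. norm (b k) \<le> 1"
  shows "\<exists>e. 0 \<preceq> e \<and> embed e \<preceq> 1 \<and> (\<forall>k. b k \<preceq> e)"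
proof -
  define c where "c = case_nat 0 b"
  have c: "star (c k) = c k" "embed (c k) \<preceq> 1" for k
    using embed_le_scalar_if_norm_le[of "c k" 1]
    by (auto simp: c_def star norm split: nat.splits)
  then obtain s where s: "star s = s" "\<And>k. c k \<preceq> s"
    using countable_sup_exists[OF msc, of c 1] by auto
  then obtain e where e: "embed e \<preceq> 1" "\<And>k. c k \<preceq> e"
    using truncation_exists[of s] c(2) by blast
  show ?thesis
    using e e(2)[of 0] e(2)[of "Suc _"] by (auto simp: c_def)
qed

end

section \<open>Dominated real-linear extension\<close>

text \<open>Separability passes to subsets of metric spaces: choose a point of \<open>S\<close> in every ball of radius
\<open>1 / (n + 1)\<close> about a point of a countable dense set that meets \<open>S\<close>.\<close>

lemma dense_sequence_in_subset:
  fixes S :: "'z::metric_space set"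
  assumes sep: "separable_space (euclidean :: 'z topology)" and "S \<noteq> {}"
  shows "\<exists>d :: nat \<Rightarrow> 'z. range d \<subseteq> S \<and> (\<forall>x\<in>S. \<exists>\<kappa>. (\<lambda>n. d (\<kappa> n)) \<longlonglongrightarrow> x)"
proof -
  obtain C :: "'z set" where C: "countable C" "closure C = UNIV"
    using sep by (auto simp: separable_space_def)
  define P where "P c n = S \<inter> ball c (inverse (real (Suc n)))" for c n
  define D where "D = (\<lambda>(c, n). SOME x. x \<in> P c n) ` {(c, n). c \<in> C \<and> P c n \<noteq> {}}"
  have P_D: "\<exists>x\<in>D. x \<in> P c n" if "c \<in> C" "P c n \<noteq> {}" for c n
    using that some_in_eq[of "P c n"] by (force simp: D_def)
  have "countable D"
    unfolding D_def
    by (rule countable_image, rule countable_subset[of _ "C \<times> UNIV"]) (use C in auto)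
  moreover have "D \<subseteq> S"
  proof
    fix x assume "x \<in> D"
    then obtain c n where "x = (SOME x. x \<in> P c n)" "P c n \<noteq> {}" by (auto simp: D_def)
    then have "x \<in> P c n" by (simp add: some_in_eq)
    then show "x \<in> S" by (simp add: P_def)
  qed
  moreover have approx: "\<exists>y\<in>D. dist y x < \<epsilon>" if x: "x \<in> S" and \<epsilon>: "\<epsilon> > 0" for x \<epsilon>
  proof -
    obtain n where n: "inverse (real (Suc n)) < \<epsilon> / 2"
      using reals_Archimedean[of "\<epsilon> / 2"] \<epsilon> by auto
    have "x \<in> closure C" by (simp add: C)
    then obtain c where c: "c \<in> C" "dist c x < inverse (real (Suc n))"
      unfolding closure_approachable by (meson inverse_positive_iff_positive of_nat_0_less_iff zero_less_Suc)
    have "x \<in> P c n" using x c by (simp add: P_def)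
    then obtain y where y: "y \<in> D" "y \<in> P c n" using P_D c by blast
    have "dist y x \<le> dist c y + dist c x" by (metis dist_triangle3 dist_commute)
    then have "dist y x < \<epsilon>" using y(2) c n by (simp add: P_def)
    then show ?thesis using y by blast
  qed
  moreover have "D \<noteq> {}" using approx \<open>S \<noteq> {}\<close> zero_less_one by blast
  ultimately have range: "range (from_nat_into D) \<subseteq> S"
    and near: "\<And>x \<epsilon>. x \<in> S \<Longrightarrow> \<epsilon> > 0 \<Longrightarrow> \<exists>k. dist (from_nat_into D k) x < \<epsilon>"
    using range_from_nat_into[of D] by (simp, metis imageE)
  have "\<exists>\<kappa>. (\<lambda>n. from_nat_into D (\<kappa> n)) \<longlonglongrightarrow> x" if "x \<in> S" for x
  proof -
    have "\<exists>k. dist (from_nat_into D k) x < inverse (real (Suc n))" for n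
      by (rule near[OF that]) simp
    then obtain \<kappa> where \<kappa>: "\<And>n. dist (from_nat_into D (\<kappa> n)) x < inverse (real (Suc n))" by metis
    have "(\<lambda>n. from_nat_into D (\<kappa> n)) \<longlonglongrightarrow> x"
      by (rule metric_tendsto_imp_tendsto[OF LIMSEQ_inverse_real_of_nat])
         (use \<kappa> in \<open>simp add: less_imp_le dist_norm\<close>)
    then show ?thesis by blast
  qed
  with range show ?thesis by blast
qed

text \<open>A partial real-linear map below \<open>\<lambda>z. (M * norm z) e\<close>, represented by its graph so that extension is
inclusion. That the graph is single-valued follows from domination, see \<open>dominated_norm_le\<close>.\<close>

definition dominated ::
    "real \<Rightarrow> 'a \<Rightarrow> ('z::real_normed_vector \<times> 'a::cstar_algebra) set \<Rightarrow> bool" where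
  "dominated M e G \<longleftrightarrow>
     subspace G \<and> (\<forall>(z, a)\<in>G. star a = a \<and> a \<preceq> (M * norm z) *\<^sub>R e)"

lemma dominatedD:
  assumes "dominated M e G" "(z, a) \<in> G"
  shows "star a = a" "a \<preceq> (M * norm z) *\<^sub>R e"
  using assms by (auto simp: dominated_def)

lemma dominated_subspace:
  assumes "dominated M e G"
  shows "(0, 0) \<in> G" "(y, a) \<in> G \<Longrightarrow> (y', a') \<in> G \<Longrightarrow> (y + y', a + a') \<in> G"
    "(y, a) \<in> G \<Longrightarrow> (r *\<^sub>R y, r *\<^sub>R a) \<in> G"
    "(y, a) \<in> G \<Longrightarrow> (y', a') \<in> G \<Longrightarrow> (y - y', a - a') \<in> G"
  using assms subspace_0[of G] subspace_add[of G "(y, a)" "(y', a')"] subspace_scale[of G "(y, a)" r]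
    subspace_diff[of G "(y, a)" "(y', a')"]
  by (auto simp: dominated_def zero_prod_def)

context
  fixes e :: "'a::cstar_algebra" and M :: real
  assumes comm: "\<And>x y :: 'a. x * y = y * x"
    and e: "0 \<preceq> e" "embed e \<preceq> 1" and M: "0 \<le> M"
begin

lemma scaleR_unit_mono: "r \<le> s \<Longrightarrow> r *\<^sub>R e \<preceq> s *\<^sub>R e"
  using scaleR_pos[OF _ e(1), of "s - r"]
  by (simp add: cstar_le_iff_diff[of "r *\<^sub>R e"] scaleR_left_diff_distrib)

lemma scaleR_mono: "0 \<le> r \<Longrightarrow> a \<preceq> b \<Longrightarrow> r *\<^sub>R a \<preceq> r *\<^sub>R b" for a b :: 'a
  using scaleR_pos[of r "b - a"]
  by (simp add: cstar_le_iff_diff[of a] cstar_le_iff_diff[of "r *\<^sub>R a"] scaleR_right_diff_distrib)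

lemma embed_scaleR_unit_le: "0 \<le> r \<Longrightarrow> embed (r *\<^sub>R e) \<preceq> r *\<^sub>R 1"
  using scaleR_pos[of r "1 - embed e"] e(2)
  by (subst cstar_le_iff_diff)
     (simp add: cstar_le_iff_diff[of "embed e"] scaleR_right_diff_distrib embed_ops(6))

text \<open>Domination at \<open>- z\<close> bounds \<open>- a\<close>, and \<open>e\<close> lies below \<open>1\<close>.\<close>

lemma dominated_norm_le:
  assumes G: "dominated M e G" and za: "(z, a) \<in> G"
  shows "norm a \<le> M * norm z"
proof (rule norm_le_if_embed_le_scalar[OF comm])
  have le: "embed b \<preceq> (M * norm y) *\<^sub>R 1" if "(y, b) \<in> G" for y b
    by (rule unital_le_trans[OF commU[OF comm] _ embed_scaleR_unit_le])
       (use dominatedD[OF G that] M in \<open>simp_all add: embed_le_iff\<close>)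
  show "embed a \<preceq> (M * norm z) *\<^sub>R 1" by (rule le[OF za])
  show "embed (- a) \<preceq> (M * norm z) *\<^sub>R 1"
    using le[of "- z" "- a"] dominated_subspace(3)[OF G za, of "-1"] by simp
qed (use dominatedD[OF G za] M in simp_all)

text \<open>All lower bounds lie below all upper bounds by the triangle inequality. The supremum over a dense
sequence of lower bounds lies below every upper bound by leastness, and above every lower bound because
the cone is closed and the partial map is continuous.\<close>

lemma separating_element_exists:
  fixes G :: "('z::real_normed_vector \<times> 'a) set" and z :: 'z
  assumes msc: "monotone_sequentially_complete TYPE('a)"
    and sep: "separable_space (euclidean :: 'z topology)" and G: "dominated M e G"
  shows "\<exists>v. star v = v \<and> (\<forall>(y, a)\<in>G. a - (M * norm (y - z)) *\<^sub>R e \<preceq> v)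
    \<and> (\<forall>(y, a)\<in>G. v \<preceq> (M * norm (y + z)) *\<^sub>R e - a)"
proof -
  have star_e: "star e = e" by (rule star_pos[OF e(1)])
  have gap: "a - (M * norm (y - z)) *\<^sub>R e \<preceq> (M * norm (y' + z)) *\<^sub>R e - a'"
    if "(y, a) \<in> G" "(y', a') \<in> G" for y a y' a'
  proof -
    have "a + a' \<preceq> (M * norm (y + y')) *\<^sub>R e"
      using dominatedD(2)[OF G] dominated_subspace(2)[OF G] that by blast
    moreover have "M * norm (y + y') \<le> M * (norm (y - z) + norm (y' + z))"
      using norm_triangle_ineq[of "y - z" "y' + z"] by (intro mult_left_mono M) simp
    ultimately have "a + a' \<preceq> (M * (norm (y - z) + norm (y' + z))) *\<^sub>R e"
      using scaleR_unit_mono cstar_le_trans[OF comm] by blast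
    then show ?thesis
      by (rule cstar_le_cong_diff[THEN iffD1, rotated]) (simp add: algebra_simps)
  qed
  obtain d :: "nat \<Rightarrow> 'z" where d: "range d \<subseteq> fst ` G"
      and dense: "\<And>x. x \<in> fst ` G \<Longrightarrow> \<exists>\<kappa>. (\<lambda>n. d (\<kappa> n)) \<longlonglongrightarrow> x"
    using dense_sequence_in_subset[OF sep, of "fst ` G"] dominated_subspace(1)[OF G] by blast
  have "\<exists>a. (d k, a) \<in> G" for k using d by force
  then obtain \<alpha> where \<alpha>: "\<And>k. (d k, \<alpha> k) \<in> G" by metis
  define b where "b k = \<alpha> k - (M * norm (d k - z)) *\<^sub>R e" for k
  have "star (b k) = b k" for k
    using dominatedD(1)[OF G \<alpha>] by (simp add: b_def star_diff star_scaleR star_e)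
  moreover have "embed (b k) \<preceq> (M * norm z) *\<^sub>R 1" for k
  proof (rule unital_le_trans[OF commU[OF comm] _ embed_scaleR_unit_le])
    show "embed (b k) \<preceq> embed ((M * norm z) *\<^sub>R e)"
      using gap[OF \<alpha> dominated_subspace(1)[OF G], of k] by (simp add: embed_le_iff b_def)
  qed (simp add: M)
  ultimately obtain v where v: "star v = v" "\<And>k. b k \<preceq> v"
      "\<And>u. star u = u \<Longrightarrow> (\<forall>k. b k \<preceq> u) \<Longrightarrow> v \<preceq> u"
    using countable_sup_exists[OF comm msc, of b] by blast
  show ?thesis
  proof (intro exI[of _ v] conjI ballI)
    show "star v = v" by (rule v(1))
  next
    fix g assume "g \<in> G"
    obtain y a where g: "g = (y, a)" by (cases g)
    with \<open>g \<in> G\<close> have ya: "(y, a) \<in> G" by simp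
    then obtain \<kappa> where dlim: "(\<lambda>n. d (\<kappa> n)) \<longlonglongrightarrow> y" using dense[of y] by force
    have "(\<lambda>n. \<alpha> (\<kappa> n)) \<longlonglongrightarrow> a"
    proof (rule LIM_zero_cancel, rule Lim_null_comparison)
      show "\<forall>\<^sub>F n in sequentially. norm (\<alpha> (\<kappa> n) - a) \<le> M * norm (d (\<kappa> n) - y)"
        using dominated_norm_le[OF G dominated_subspace(4)[OF G \<alpha> ya]] by simp
      show "(\<lambda>n. M * norm (d (\<kappa> n) - y)) \<longlonglongrightarrow> 0"
        using tendsto_mult_left[OF tendsto_norm[OF LIM_zero[OF dlim]], of M] by simp
    qed
    then have "(\<lambda>n. v - b (\<kappa> n)) \<longlonglongrightarrow> v - (a - (M * norm (y - z)) *\<^sub>R e)"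
      unfolding b_def by (intro tendsto_intros dlim)
    then have "v - (a - (M * norm (y - z)) *\<^sub>R e) \<in> {a. 0 \<preceq> a}"
      by (rule closed_sequentially[OF closed_cone[OF comm], rotated])
         (simp add: v(2) flip: cstar_le_iff_diff)
    then show "case g of (y, a) \<Rightarrow> a - (M * norm (y - z)) *\<^sub>R e \<preceq> v"
      by (simp add: g flip: cstar_le_iff_diff)
    have "v \<preceq> (M * norm (y + z)) *\<^sub>R e - a"
      using gap[OF \<alpha> ya] dominatedD(1)[OF G ya]
      by (intro v(3)) (simp_all add: b_def star_diff star_scaleR star_e)
    then show "case g of (y, a) \<Rightarrow> v \<preceq> (M * norm (y + z)) *\<^sub>R e - a" by (simp add: g)
  qed
qed

text \<open>For \<open>t \<noteq> 0\<close>, domination of \<open>a + t v\<close> reduces by homogeneity to \<open>t = 1\<close> and \<open>t = - 1\<close>, where it is the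
hypothesis \<open>upper\<close> or \<open>lower\<close>.\<close>

lemma dominated_one_step:
  fixes G :: "('z::real_normed_vector \<times> 'a) set" and z :: 'z
  assumes G: "dominated M e G" and v: "star v = v"
    and lower: "\<And>y a. (y, a) \<in> G \<Longrightarrow> a - (M * norm (y - z)) *\<^sub>R e \<preceq> v"
    and upper: "\<And>y a. (y, a) \<in> G \<Longrightarrow> v \<preceq> (M * norm (y + z)) *\<^sub>R e - a"
  shows "dominated M e {g + h |g h. g \<in> G \<and> h \<in> span {(z, v)}}"
  unfolding dominated_def
proof (intro conjI ballI)
  show "subspace {g + h |g h. g \<in> G \<and> h \<in> span {(z, v)}}"
    using G by (intro subspace_sums subspace_span) (simp add: dominated_def)
  fix x assume "x \<in> {g + h |g h. g \<in> G \<and> h \<in> span {(z, v)}}"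
  then obtain y a t where ya: "(y, a) \<in> G" and x: "x = (y + t *\<^sub>R z, a + t *\<^sub>R v)"
    by (auto simp: span_singleton)
  have scaled: "(inverse r *\<^sub>R y, inverse r *\<^sub>R a) \<in> G" for r
    using dominated_subspace(3)[OF G ya] .
  have "a + t *\<^sub>R v \<preceq> (M * norm (y + t *\<^sub>R z)) *\<^sub>R e"
  proof (cases t "0 :: real" rule: linorder_cases)
    case equal then show ?thesis using dominatedD(2)[OF G ya] by simp
  next
    case greater
    then have "norm (inverse t *\<^sub>R y + z) = inverse t * norm (y + t *\<^sub>R z)"
      using norm_scaleR[of "inverse t" "y + t *\<^sub>R z"] by (simp add: scaleR_add_right)
    then have "t *\<^sub>R (M * norm (inverse t *\<^sub>R y + z)) *\<^sub>R e = (M * norm (y + t *\<^sub>R z)) *\<^sub>R e"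
      "t *\<^sub>R inverse t *\<^sub>R a = a"
      using greater by simp_all
    with scaleR_mono[OF less_imp_le[OF greater] upper[OF scaled, of t]]
    have "t *\<^sub>R v \<preceq> (M * norm (y + t *\<^sub>R z)) *\<^sub>R e - a"
      by (simp only: scaleR_right_diff_distrib)
    then show ?thesis
      by (rule cstar_le_cong_diff[THEN iffD1, rotated]) (simp add: algebra_simps)
  next
    case less
    define r where "r = - t"
    then have r: "r > 0" using less by simp
    then have "norm (inverse r *\<^sub>R y - z) = inverse r * norm (y - r *\<^sub>R z)"
      using norm_scaleR[of "inverse r" "y - r *\<^sub>R z"] by (simp add: scaleR_diff_right)
    then have "r *\<^sub>R (M * norm (inverse r *\<^sub>R y - z)) *\<^sub>R e = (M * norm (y - r *\<^sub>R z)) *\<^sub>R e"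
      "r *\<^sub>R inverse r *\<^sub>R a = a"
      using r by simp_all
    with scaleR_mono[OF less_imp_le[OF r] lower[OF scaled, of r]]
    have "a - (M * norm (y - r *\<^sub>R z)) *\<^sub>R e \<preceq> r *\<^sub>R v"
      by (simp only: scaleR_right_diff_distrib)
    then show ?thesis
      by (rule cstar_le_cong_diff[THEN iffD1, rotated]) (simp add: algebra_simps r_def)
  qed
  then show "case x of (z, a) \<Rightarrow> star a = a \<and> a \<preceq> (M * norm z) *\<^sub>R e"
    using dominatedD(1)[OF G ya] by (simp add: x star_add star_scaleR v)
qed

lemma total_dominated_exists:
  fixes G0 :: "('z::real_normed_vector \<times> 'a) set"
  assumes msc: "monotone_sequentially_complete TYPE('a)"
    and sep: "separable_space (euclidean :: 'z topology)" and G0: "dominated M e G0"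
  shows "\<exists>G. G0 \<subseteq> G \<and> dominated M e G \<and> fst ` G = UNIV"
proof -
  let ?F = "{G. G0 \<subseteq> G \<and> dominated M e G}"
  have "\<exists>G\<in>?F. \<forall>X\<in>?F. G \<subseteq> X \<longrightarrow> X = G"
  proof (rule subset_Zorn_nonempty)
    show "?F \<noteq> {}" using G0 by blast
    fix \<C> assume ne: "\<C> \<noteq> {}" and chain: "subset.chain ?F \<C>"
    then have F: "G0 \<subseteq> G" "dominated M e G" if "G \<in> \<C>" for G
      using that by (auto simp: subset.chain_def)
    have common: "\<exists>G\<in>\<C>. x \<in> G \<and> y \<in> G" if "x \<in> \<Union>\<C>" "y \<in> \<Union>\<C>" for x y
      using that chain unfolding subset_chain_def by blast
    have "subspace (\<Union>\<C>)"
    proof (rule subspaceI)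
      show "0 \<in> \<Union>\<C>" using ne F(2) subspace_0 unfolding dominated_def by blast
      show "x + y \<in> \<Union>\<C>" if "x \<in> \<Union>\<C>" "y \<in> \<Union>\<C>" for x y
        using common[OF that] F(2) subspace_add unfolding dominated_def by blast
      show "c *\<^sub>R x \<in> \<Union>\<C>" if "x \<in> \<Union>\<C>" for c x
        using that F(2) subspace_scale unfolding dominated_def by blast
    qed
    then have "dominated M e (\<Union>\<C>)"
      using F(2) unfolding dominated_def by blast
    then show "\<Union>\<C> \<in> ?F" using ne F(1) by blast
  qed
  then obtain G where "G \<in> ?F" and max: "\<forall>X\<in>?F. G \<subseteq> X \<longrightarrow> X = G" ..
  then have G: "G0 \<subseteq> G" "dominated M e G" by simp_all
  have "z \<in> fst ` G" for z
  proof -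
    obtain v where v: "star v = v" "\<forall>(y, a)\<in>G. a - (M * norm (y - z)) *\<^sub>R e \<preceq> v"
        "\<forall>(y, a)\<in>G. v \<preceq> (M * norm (y + z)) *\<^sub>R e - a"
      using separating_element_exists[OF msc sep G(2)] by blast
    define X where "X = {g + h |g h. g \<in> G \<and> h \<in> span {(z, v)}}"
    have "dominated M e X"
      unfolding X_def by (rule dominated_one_step[OF G(2) v(1)]) (use v in auto)
    moreover have "G \<subseteq> X"
    proof
      fix g assume "g \<in> G"
      then have "g + 0 \<in> X" unfolding X_def using span_zero by blast
      then show "g \<in> X" by simp
    qed
    moreover have "G0 \<subseteq> X" using G(1) \<open>G \<subseteq> X\<close> by (rule subset_trans)
    ultimately have "X = G" using max by simp
    have "0 + (z, v) \<in> X"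
      unfolding X_def using dominated_subspace(1)[OF G(2)] span_base[of "(z, v)" "{(z, v)}"]
      by (auto simp: zero_prod_def simp del: add_0)
    then show ?thesis using \<open>X = G\<close> by force
  qed
  then show ?thesis using G by blast
qed

lemma dominated_functional_exists:
  fixes G0 :: "('z::real_normed_vector \<times> 'a) set"
  assumes msc: "monotone_sequentially_complete TYPE('a)"
    and sep: "separable_space (euclidean :: 'z topology)" and G0: "dominated M e G0"
  shows "\<exists>f. linear f \<and> (\<forall>(y, a)\<in>G0. f y = a) \<and> (\<forall>z. star (f z) = f z \<and> norm (f z) \<le> M * norm z)"
proof -
  obtain G where G: "G0 \<subseteq> G" "dominated M e G" "fst ` G = UNIV"
    using total_dominated_exists[OF assms] by blast
  have unique: "a = a'" if "(z, a) \<in> G" "(z, a') \<in> G" for z a a'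
    using dominated_norm_le[OF G(2) dominated_subspace(4)[OF G(2) that]] by simp
  have "\<exists>a. (z, a) \<in> G" for z using G(3) by (metis UNIV_I imageE prod.collapse)
  then obtain f where f: "\<And>z. (z, f z) \<in> G" by metis
  have "linear f"
    by (rule linearI; rule unique[OF f]) (intro dominated_subspace[OF G(2)] f)+
  moreover have "\<forall>(y, a)\<in>G0. f y = a" using unique[OF f] G(1) by auto
  moreover have "\<forall>z. star (f z) = f z \<and> norm (f z) \<le> M * norm z"
    using dominatedD(1)[OF G(2) f] dominated_norm_le[OF G(2) f] by blast
  ultimately show ?thesis by blast
qed

end

section \<open>Complex-linear extension\<close>

lemma onorm_on_bound:
  assumes T: "bounded_clinear_on Y T" and "0 \<in> Y"
  shows "0 \<le> onorm_on Y T" "y \<in> Y \<Longrightarrow> norm (T y) \<le> onorm_on Y T * norm y"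
proof -
  obtain K where K: "\<And>y. y \<in> Y \<Longrightarrow> norm (T y) \<le> K * norm y"
    using T unfolding bounded_clinear_on_def by blast
  have "norm (T y) / norm y \<le> max K 0" if "y \<in> Y" for y
    using K[OF that] by (cases "y = 0") (auto simp: divide_le_eq le_max_iff_disj)
  then have bdd: "bdd_above ((\<lambda>y. norm (T y) / norm y) ` Y)" by (rule bdd_aboveI2)
  show "0 \<le> onorm_on Y T"
    unfolding onorm_on_def by (rule cSUP_upper2[OF bdd \<open>0 \<in> Y\<close>]) simp
  assume y: "y \<in> Y"
  show "norm (T y) \<le> onorm_on Y T * norm y"
  proof (cases "y = 0")
    case True then show ?thesis using K[OF y] by simp
  next
    case False
    have "norm (T y) / norm y \<le> onorm_on Y T"
      unfolding onorm_on_def by (rule cSUP_upper[OF y bdd])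
    then show ?thesis using False by (simp add: divide_le_eq)
  qed
qed

lemma onorm_on_extension:
  assumes T: "bounded_clinear_on Y T" and Y: "0 \<in> Y"
    and T': "bounded_clinear_on UNIV T'" and ext: "\<And>y. y \<in> Y \<Longrightarrow> T' y = T y"
    and le: "\<And>x. norm (T' x) \<le> onorm_on Y T * norm x"
  shows "onorm_on UNIV T' = onorm_on Y T"
proof (rule antisym)
  show "onorm_on UNIV T' \<le> onorm_on Y T"
    unfolding onorm_on_def[of UNIV]
  proof (rule cSUP_least)
    fix x
    show "norm (T' x) / norm x \<le> onorm_on Y T"
      using le[of x] onorm_on_bound(1)[OF T Y] by (cases "x = 0") (simp_all add: divide_le_eq)
  qed simp
  show "onorm_on Y T \<le> onorm_on UNIV T'"
    unfolding onorm_on_def[of Y]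
  proof (rule cSUP_least)
    fix y assume "y \<in> Y"
    then show "norm (T y) / norm y \<le> onorm_on UNIV T'"
      using onorm_on_bound(1)[OF T' UNIV_I] onorm_on_bound(2)[OF T' UNIV_I UNIV_I, of y] ext[of y]
      by (cases "y = 0") (simp_all add: divide_le_eq)
  qed (use Y in auto)
qed

lemma re_part_add: "re_part (x + y) = re_part x + re_part y"
  by (simp add: re_part_def star_add scaleR_add_right add_ac)

lemma re_part_scaleR: "re_part (r *\<^sub>R x) = r *\<^sub>R re_part x"
  by (simp add: re_part_def star_scaleR scaleR_add_right mult.commute)

text \<open>The real part of \<open>\<i>\<close> times a self-adjoint element vanishes.\<close>

lemma re_part_complexification:
  fixes f :: "'z::complex_vector \<Rightarrow> 'a::cstar_algebra"
  assumes "star (f x) = f x" "star (f (\<i> *\<^sub>C x)) = f (\<i> *\<^sub>C x)"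
  shows "re_part (f x - \<i> *\<^sub>C f (\<i> *\<^sub>C x)) = f x"
  using assms
  by (simp add: re_part_def star_diff star_scaleC scaleC_minus_left flip: scaleR_2)

lemma complexification_scaleC:
  fixes f :: "'z::complex_vector \<Rightarrow> 'a::complex_vector"
  assumes "linear f"
  defines "F \<equiv> \<lambda>x. f x - \<i> *\<^sub>C f (\<i> *\<^sub>C x)"
  shows "F (c *\<^sub>C x) = c *\<^sub>C F x"
proof -
  interpret f: linear f by fact
  have real: "F (r *\<^sub>R y) = r *\<^sub>R F y" for r y
    by (simp add: F_def scaleC_scaleR f.scale scaleR_diff_right)
  have imag: "F (\<i> *\<^sub>C y) = \<i> *\<^sub>C F y" for y
    by (simp add: F_def scaleC_scaleC scaleC_minus_left scaleC_one f.neg scaleC_diff_right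
        scaleC_minus_right)
  have add: "F (y + z) = F y + F z" for y z
    by (simp add: F_def f.add scaleC_add_right)
  have split: "c *\<^sub>C y = Re c *\<^sub>R y + Im c *\<^sub>R (\<i> *\<^sub>C y)" for y :: "'b::complex_vector"
    by (simp add: scaleC_scaleC mult.commute flip: scaleC_of_real scaleC_add_left complex_eq)
  show ?thesis unfolding split by (simp only: add real imag)
qed

text \<open>The element \<open>e\<close> is chosen above the normalized values on a dense sequence of \<open>Y\<close>; by continuity and
closedness of the cone the domination holds on all of \<open>Y\<close>.\<close>

lemma real_dominated_graph:
  fixes T :: "'z::complex_banach \<Rightarrow> 'a::cstar_algebra"
  assumes comm: "\<And>x y :: 'a. x * y = y * x"
    and msc: "monotone_sequentially_complete TYPE('a)"
    and sep: "separable_space (euclidean :: 'z topology)"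
    and Y: "csubspace Y" and T: "bounded_clinear_on Y T"
  shows "\<exists>e. 0 \<preceq> e \<and> embed e \<preceq> 1 \<and>
    dominated (onorm_on Y T) e ((\<lambda>y. (y, re_part (T y))) ` Y)"
proof -
  let ?M = "onorm_on Y T"
  have Y0: "0 \<in> Y" using Y by (rule complex_vector.subspace_0)
  have M: "0 \<le> ?M" and normT: "\<And>y. y \<in> Y \<Longrightarrow> norm (T y) \<le> ?M * norm y"
    using onorm_on_bound[OF T Y0] by auto
  have Yadd: "x + y \<in> Y" if "x \<in> Y" "y \<in> Y" for x y
    using Y that by (rule complex_vector.subspace_add)
  have Yscale: "r *\<^sub>R y \<in> Y" if "y \<in> Y" for r y
    using complex_vector.subspace_scale[OF Y that, of "of_real r"] by (simp add: scaleC_of_real)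
  have Tadd: "T (x + y) = T x + T y" if "x \<in> Y" "y \<in> Y" for x y
    using T that by (simp add: bounded_clinear_on_def)
  have Tscale: "T (r *\<^sub>R y) = r *\<^sub>R T y" if "y \<in> Y" for r y
  proof -
    have "T (of_real r *\<^sub>C y) = of_real r *\<^sub>C T y" using T that by (simp add: bounded_clinear_on_def)
    then show ?thesis by (simp add: scaleC_of_real)
  qed
  let ?R = "\<lambda>y. re_part (T y)"
  have Radd: "?R (x + y) = ?R x + ?R y" if "x \<in> Y" "y \<in> Y" for x y
    by (simp add: Tadd that re_part_add)
  have Rscale: "?R (r *\<^sub>R y) = r *\<^sub>R ?R y" if "y \<in> Y" for r y
    by (simp add: Tscale that re_part_scaleR)
  have normR: "norm (?R y) \<le> ?M * norm y" if "y \<in> Y" for y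
    using norm_re_part[of "T y"] normT[OF that] by simp
  obtain d :: "nat \<Rightarrow> 'z" where d: "\<And>k. d k \<in> Y"
      and dense: "\<And>x. x \<in> Y \<Longrightarrow> \<exists>\<kappa>. (\<lambda>n. d (\<kappa> n)) \<longlonglongrightarrow> x"
    using dense_sequence_in_subset[OF sep, of Y] Y0 by blast
  define b where "b k = inverse (?M * norm (d k)) *\<^sub>R ?R (d k)" for k
  have "star (b k) = b k" for k by (simp add: b_def star_scaleR)
  moreover have "norm (b k) \<le> 1" for k
    using normR[OF d, of k] M
    by (cases "?M * norm (d k) = 0") (auto simp: b_def abs_mult field_simps mult_less_0_iff zero_less_mult_iff)
  ultimately obtain e where e: "0 \<preceq> e" "embed e \<preceq> 1" "\<And>k. b k \<preceq> e"
    using countable_local_unit_exists[OF comm msc, of b] by blast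
  have on_dense: "0 \<preceq> (?M * norm (d k)) *\<^sub>R e - ?R (d k)" for k
  proof (cases "?M * norm (d k) = 0")
    case True
    have "?R (d k) = 0" using normR[OF d, of k] unfolding True by simp
    then show ?thesis using cstar_le_refl[of 0] unfolding True by simp
  next
    case False
    have "0 \<preceq> (?M * norm (d k)) *\<^sub>R (e - b k)"
      using e(3)[of k] M by (intro scaleR_pos) (simp_all flip: cstar_le_iff_diff)
    moreover have "(?M * norm (d k)) *\<^sub>R b k = ?R (d k)"
      unfolding b_def scaleR_scaleR right_inverse[OF False] by simp
    ultimately show ?thesis by (simp only: scaleR_right_diff_distrib)
  qed
  have bound: "?R y \<preceq> (?M * norm y) *\<^sub>R e" if y: "y \<in> Y" for y
  proof -
    obtain \<kappa> where dlim: "(\<lambda>n. d (\<kappa> n)) \<longlonglongrightarrow> y" using dense[OF y] by blast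
    have "(\<lambda>n. ?R (d (\<kappa> n))) \<longlonglongrightarrow> ?R y"
    proof (rule LIM_zero_cancel, rule Lim_null_comparison)
      have "?R (d (\<kappa> n)) - ?R y = ?R (d (\<kappa> n) - y)" for n
        using Radd[OF d Yscale[OF y, of "-1"], of "\<kappa> n"] Rscale[OF y, of "-1"] by simp
      then show "\<forall>\<^sub>F n in sequentially. norm (?R (d (\<kappa> n)) - ?R y) \<le> ?M * norm (d (\<kappa> n) - y)"
        using normR[OF Yadd[OF d Yscale[OF y, of "-1"]]] by simp
      show "(\<lambda>n. ?M * norm (d (\<kappa> n) - y)) \<longlonglongrightarrow> 0"
        using tendsto_mult_left[OF tendsto_norm[OF LIM_zero[OF dlim]], of ?M] by simp
    qed
    then have "(\<lambda>n. (?M * norm (d (\<kappa> n))) *\<^sub>R e - ?R (d (\<kappa> n))) \<longlonglongrightarrow> (?M * norm y) *\<^sub>R e - ?R y"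
      by (intro tendsto_intros dlim)
    then have "(?M * norm y) *\<^sub>R e - ?R y \<in> {a. 0 \<preceq> a}"
      by (rule closed_sequentially[OF closed_cone[OF comm], rotated]) (simp add: on_dense)
    then show ?thesis by (simp flip: cstar_le_iff_diff)
  qed
  have "subspace ((\<lambda>y. (y, ?R y)) ` Y)"
  proof (rule subspaceI)
    have "?R 0 = 0" using normR[OF Y0] by simp
    then show "0 \<in> (\<lambda>y. (y, ?R y)) ` Y" using Y0 by (force simp: zero_prod_def)
    show "x + y \<in> (\<lambda>y. (y, ?R y)) ` Y"
      if "x \<in> (\<lambda>y. (y, ?R y)) ` Y" "y \<in> (\<lambda>y. (y, ?R y)) ` Y" for x y
      using that by (auto simp: Radd[symmetric] Yadd)
    show "c *\<^sub>R x \<in> (\<lambda>y. (y, ?R y)) ` Y" if "x \<in> (\<lambda>y. (y, ?R y)) ` Y" for c x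
      using that by (auto simp: Rscale[symmetric] Yscale)
  qed
  then show ?thesis using e(1,2) bound by (auto simp: dominated_def intro!: exI[of _ e])
qed

theorem mainTheorem2:
  assumes "\<forall>x y :: 'a::cstar_algebra. x * y = y * x"
    and "monotone_sequentially_complete TYPE('a)"
  shows "one_separably_injective TYPE('z::complex_banach) TYPE('a)"
  unfolding one_separably_injective_def
proof (intro impI allI, elim conjE)
  fix Y :: "'z set" and T :: "'z \<Rightarrow> 'a"
  assume sep: "separable_space (euclidean :: 'z topology)"
    and Y: "csubspace Y" and T: "bounded_clinear_on Y T"
  have comm: "x * y = y * x" for x y :: 'a using assms(1) by blast
  let ?M = "onorm_on Y T"
  have Y0: "0 \<in> Y" using Y by (rule complex_vector.subspace_0)
  have M: "0 \<le> ?M" using onorm_on_bound(1)[OF T Y0] .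
  obtain e where e: "0 \<preceq> e" "embed e \<preceq> 1"
      and G: "dominated ?M e ((\<lambda>y. (y, re_part (T y))) ` Y)"
    using real_dominated_graph[OF comm assms(2) sep Y T] by blast
  obtain f where f: "linear f" and fY: "\<And>y. y \<in> Y \<Longrightarrow> f y = re_part (T y)"
      and starf: "\<And>z. star (f z) = f z" and normf: "\<And>z. norm (f z) \<le> ?M * norm z"
    using dominated_functional_exists[OF comm e M assms(2) sep G] by auto
  define F where "F x = f x - \<i> *\<^sub>C f (\<i> *\<^sub>C x)" for x
  have F_scaleC: "F (c *\<^sub>C x) = c *\<^sub>C F x" for c x
    unfolding F_def by (rule complexification_scaleC[OF f])
  have re_F: "re_part (F x) = f x" for x
    unfolding F_def by (rule re_part_complexification[OF starf starf])
  have F_add: "F (x + y) = F x + F y" for x y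
    by (simp add: F_def linear_add[OF f] scaleC_add_right)
  have normF: "norm (F x) \<le> ?M * norm x" for x
  proof (rule norm_le_if_re_parts[OF comm])
    fix \<zeta> :: complex assume "cmod \<zeta> = 1"
    then show "norm (re_part (\<zeta> *\<^sub>C F x)) \<le> ?M * norm x"
      using normf[of "\<zeta> *\<^sub>C x"] by (simp add: norm_scaleC re_F flip: F_scaleC)
  qed (simp add: M)
  have ext: "F y = T y" if y: "y \<in> Y" for y
  proof -
    have "\<i> *\<^sub>C y \<in> Y" using Y y by (rule complex_vector.subspace_scale)
    then have "f (\<i> *\<^sub>C y) = re_part (\<i> *\<^sub>C T y)"
      using T y by (simp add: fY bounded_clinear_on_def)
    also have "\<dots> = - im_part (T y)"
      using re_part_scaleR[of "- 1" "\<i> *\<^sub>C T y"] by (simp add: im_part_def scaleC_minus_left)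
    finally show ?thesis
      using re_im_part[of "T y"] by (simp add: F_def fY y scaleC_minus_right)
  qed
  have F: "bounded_clinear_on UNIV F"
    unfolding bounded_clinear_on_def using F_add F_scaleC normF by blast
  then show "\<exists>T'. bounded_clinear_on UNIV T' \<and> (\<forall>y\<in>Y. T' y = T y) \<and> onorm_on UNIV T' = onorm_on Y T"
    using onorm_on_extension[OF T Y0 F ext normF] ext by blast
qed

end
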